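(* Let $m\ge1$ be an integer, let $-\Delta_m\in\mathbb{R}^{m\times m}$ be symmetric positive definite, let $T>0$ and $\gamma>0$. For each $n\ge1$ put $\tau=T/n$, $\alpha=\tau^2/\sqrt\gamma$, and let $$\mathcal{T}=B_n^{(1)}\otimes I_m-\tfrac{\tau^2}{2}B_n^{(2)}\otimes\Delta_m,\qquad \mathcal{A}=\begin{bmatrix}\alpha\check I_n\otimes I_m & \mathcal{T}^T\\ \mathcal{T} & -\alpha\hat I_n\otimes I_m\end{bmatrix}\in\mathbb{R}^{2mn\times2mn},$$ $$G=G_n^{(1)}\otimes I_m-\tfrac{\tau^2}{2}G_n^{(2)}\otimes\Delta_m,\qquad \mathcal{P}_G=\begin{bmatrix}\sqrt{G^TG+\alpha^2I_{mn}} & \\ & \sqrt{GG^T+\alpha^2I_{mn}}\end{bmatrix}\in\mathbb{R}^{2mn\times2mn}.$$ Then for any $\epsilon>0$ there exists an integer $K$ such that for all $n>4Km$ $$\mathcal{P}_G^{-1}\mathcal{A}=\overline{\mathcal{Q}}+\overline{\mathcal{E}}_0+\overline{\mathcal{R}}_0,$$ where $\overline{\mathcal{Q}}$ is both real symmetric and orthogonal, $\|\overline{\mathcal{E}}_0\|_2\le\epsilon$, and $\mathrm{rank}(\overline{\mathcal{R}}_0)\le(8K+2)m$.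
   Context: $B_n^{(1)}\in\mathbb{R}^{n\times n}$ is the lower triangular Toeplitz matrix with $1$ on the diagonal, $-2$ on the first subdiagonal, $1$ on the second subdiagonal and $0$ elsewhere. $B_n^{(2)}\in\mathbb{R}^{n\times n}$ is the lower triangular Toeplitz matrix with $1$ on the diagonal, $0$ on the first subdiagonal, $1$ on the second subdiagonal and $0$ elsewhere. $\hat I_n=\mathrm{diag}(\frac12,1,\dots,1)$ and $\check I_n=\mathrm{diag}(1,\dots,1,\frac12)$, both $n\times n$. $G_n^{(1)}\in\mathbb{R}^{n\times n}$ is the symmetric tridiagonal Toeplitz matrix with $2$ on the diagonal and $-1$ on the sub- and superdiagonals. $G_n^{(2)}\in\mathbb{R}^{n\times n}$ is the symmetric tridiagonal Toeplitz matrix with $0$ on the diagonal and $-1$ on the sub- and superdiagonals. $\sqrt{\cdot}$ applied to a matrix is the symmetric positive semidefinite square root and $\|\cdot\|_2$ is the spectral norm. *)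

theory Defs
  imports
    Complex_Main
    "Jordan_Normal_Form.DL_Rank"
    "Jordan_Normal_Form.Gauss_Jordan_Elimination"
begin

(* Matrices are those of Jordan_Normal_Form, whose size is a value, because the statement
   quantifies over the size n.  Indices start at 0. *)

definition kron :: "real mat \<Rightarrow> real mat \<Rightarrow> real mat" where
  "kron A B = mat (dim_row A * dim_row B) (dim_col A * dim_col B)
     (\<lambda>(i, j). A $$ (i div dim_row B, j div dim_col B) * B $$ (i mod dim_row B, j mod dim_col B))"

(* t k is the entry on the k-th subdiagonal, and on the (-k)-th superdiagonal if k < 0 *)
definition toeplitz :: "nat \<Rightarrow> (int \<Rightarrow> real) \<Rightarrow> real mat" where
  "toeplitz n t = mat n n (\<lambda>(i, j). t (int i - int j))"

definition symmetric_mat :: "real mat \<Rightarrow> bool" where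
  "symmetric_mat A \<longleftrightarrow> transpose_mat A = A"

(* The library constant orthogonal_mat only asks for pairwise orthogonal nonzero columns,
   not for orthonormal ones. *)
definition orthonormal_mat :: "nat \<Rightarrow> real mat \<Rightarrow> bool" where
  "orthonormal_mat N A \<longleftrightarrow> A \<in> carrier_mat N N \<and>
     transpose_mat A * A = 1\<^sub>m N \<and> A * transpose_mat A = 1\<^sub>m N"

definition sym_pos_def :: "nat \<Rightarrow> real mat \<Rightarrow> bool" where
  "sym_pos_def N A \<longleftrightarrow> A \<in> carrier_mat N N \<and> symmetric_mat A \<and>
     (\<forall>v \<in> carrier_vec N. v \<noteq> 0\<^sub>v N \<longrightarrow> v \<bullet> (A *\<^sub>v v) > 0)"

definition sym_pos_semidef :: "nat \<Rightarrow> real mat \<Rightarrow> bool" where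
  "sym_pos_semidef N A \<longleftrightarrow> A \<in> carrier_mat N N \<and> symmetric_mat A \<and>
     (\<forall>v \<in> carrier_vec N. v \<bullet> (A *\<^sub>v v) \<ge> 0)"

(* Meaningful when A is symmetric positive semidefinite: the root then exists and is unique. *)
definition sqrt_mat :: "real mat \<Rightarrow> real mat" where
  "sqrt_mat A = (THE X. sym_pos_semidef (dim_row A) X \<and> X * X = A)"

definition norm2_vec :: "real vec \<Rightarrow> real" where
  "norm2_vec v = sqrt (v \<bullet> v)"

(* The spectral norm, as the operator norm induced by the Euclidean norm.
   Only meaningful for matrices with at least one column. *)
definition norm2_mat :: "real mat \<Rightarrow> real" where
  "norm2_mat A = (SUP v \<in> {v \<in> carrier_vec (dim_col A). norm2_vec v = 1}. norm2_vec (A *\<^sub>v v))"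

(* The library function mat_inverse yields None for singular matrices. *)
definition inv_mat :: "real mat \<Rightarrow> real mat" where
  "inv_mat A = the (mat_inverse A)"

definition B1 :: "nat \<Rightarrow> real mat" where
  "B1 n = toeplitz n (\<lambda>k. if k = 0 then 1 else if k = 1 then -2 else if k = 2 then 1 else 0)"

definition B2 :: "nat \<Rightarrow> real mat" where
  "B2 n = toeplitz n (\<lambda>k. if k = 0 then 1 else if k = 2 then 1 else 0)"

definition G1 :: "nat \<Rightarrow> real mat" where
  "G1 n = toeplitz n (\<lambda>k. if k = 0 then 2 else if \<bar>k\<bar> = 1 then -1 else 0)"

definition G2 :: "nat \<Rightarrow> real mat" where
  "G2 n = toeplitz n (\<lambda>k. if \<bar>k\<bar> = 1 then -1 else 0)"

definition I_hat :: "nat \<Rightarrow> real mat" where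
  "I_hat n = mat_diag n (\<lambda>i. if i = 0 then 1/2 else 1)"

definition I_check :: "nat \<Rightarrow> real mat" where
  "I_check n = mat_diag n (\<lambda>i. if Suc i = n then 1/2 else 1)"

definition tau :: "real \<Rightarrow> nat \<Rightarrow> real" where
  "tau T n = T / real n"

definition alpha :: "real \<Rightarrow> real \<Rightarrow> nat \<Rightarrow> real" where
  "alpha T \<gamma> n = (tau T n)\<^sup>2 / sqrt \<gamma>"

definition T_mat :: "nat \<Rightarrow> real mat \<Rightarrow> real \<Rightarrow> nat \<Rightarrow> real mat" where
  "T_mat m \<Delta> T n = kron (B1 n) (1\<^sub>m m) - ((tau T n)\<^sup>2 / 2) \<cdot>\<^sub>m kron (B2 n) \<Delta>"

definition A_mat :: "nat \<Rightarrow> real mat \<Rightarrow> real \<Rightarrow> real \<Rightarrow> nat \<Rightarrow> real mat" where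
  "A_mat m \<Delta> T \<gamma> n = four_block_mat
     (alpha T \<gamma> n \<cdot>\<^sub>m kron (I_check n) (1\<^sub>m m))  (transpose_mat (T_mat m \<Delta> T n))
     (T_mat m \<Delta> T n)                          (- (alpha T \<gamma> n \<cdot>\<^sub>m kron (I_hat n) (1\<^sub>m m)))"

definition G_mat :: "nat \<Rightarrow> real mat \<Rightarrow> real \<Rightarrow> nat \<Rightarrow> real mat" where
  "G_mat m \<Delta> T n = kron (G1 n) (1\<^sub>m m) - ((tau T n)\<^sup>2 / 2) \<cdot>\<^sub>m kron (G2 n) \<Delta>"

definition P_G :: "nat \<Rightarrow> real mat \<Rightarrow> real \<Rightarrow> real \<Rightarrow> nat \<Rightarrow> real mat" where
  "P_G m \<Delta> T \<gamma> n = (let G = G_mat m \<Delta> T n; a = alpha T \<gamma> n in four_block_mat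
     (sqrt_mat (transpose_mat G * G + a\<^sup>2 \<cdot>\<^sub>m 1\<^sub>m (m * n)))  (0\<^sub>m (m * n) (m * n))
     (0\<^sub>m (m * n) (m * n))  (sqrt_mat (G * transpose_mat G + a\<^sup>2 \<cdot>\<^sub>m 1\<^sub>m (m * n))))"

end

(* T is a shifted copy of -G up to its first block row: with the cyclic shift Z, acting on the
   time index only, T + Z G and the commutator Z G - G Z have rank O(m).  G is diagonalized by the
   sine transform in time and an eigenbasis of Delta in space, which also diagonalizes
   H = sqrt (G^2 + a^2), where a = alpha.  Replacing T by -Z G, the polar factor of the symmetric
   matrix A is Q, and the error is governed by H^-1 (Z H - H Z).  Since |H - G| <= C / n^2 while all
   but K m eigenvalues of H exceed a large multiple of C / n^2, this error is small up to low rank. *)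

theory Submission
  imports Defs "Jordan_Normal_Form.Spectral_Radius"
begin

section \<open>Orthonormal matrices and the real spectral theorem\<close>

text \<open>The square root destroys the Toeplitz structure: nothing makes Z H - H Z itself of low
  rank, although Z G - G Z is. Hence the detour through H - G, which is small in norm, but not in
  comparison with the smallest eigenvalues of H, which may be of order 1 / n^2 as well; those have
  to be cut off. The cutoff index does not depend on n because all quantities live on one scale: a,
  tau^2 and H - G are O(1 / n^2), while the eigenvalues of G at time frequency k = 1, ..., n are at
  least (k^2 / 4 - const) / n^2. G may be indefinite, but its negative eigenvalues are also only O(1
  / n^2), so H stays close to G rather than to -G. The shift is cyclic, and not truncated, so that Z
  is orthogonal: diag(I, Z) is then an orthogonal congruence, which makes Q symmetric and orthogonal
  at once, and the wrap-around costs nothing but rank.\<close>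

lemma mult_square_mat_carrier [simp]:
  "A \<in> carrier_mat n n \<Longrightarrow> B \<in> carrier_mat n n \<Longrightarrow> A * B \<in> carrier_mat n n"
  by (rule mult_carrier_mat)

lemma mult_square_mat_vec_carrier [simp]:
  "A \<in> carrier_mat n n \<Longrightarrow> v \<in> carrier_vec n \<Longrightarrow> A *\<^sub>v v \<in> carrier_vec n"
  by (rule mult_mat_vec_carrier)

lemma orthonormal_matD:
  assumes "orthonormal_mat n W"
  shows "W \<in> carrier_mat n n" "transpose_mat W \<in> carrier_mat n n"
    "transpose_mat W * W = 1\<^sub>m n" "W * transpose_mat W = 1\<^sub>m n"
  using assms unfolding orthonormal_mat_def by auto

lemma orthonormal_matI:
  fixes W :: "real mat"
  assumes W: "W \<in> carrier_mat n n" and "W * transpose_mat W = 1\<^sub>m n"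
  shows "orthonormal_mat n W"
proof -
  have "transpose_mat W * W = 1\<^sub>m n"
    by (rule mat_mult_left_right_inverse[OF W _ assms(2)]) (use W in auto)
  then show ?thesis using assms unfolding orthonormal_mat_def by auto
qed

lemma orthonormal_mat_transpose:
  "orthonormal_mat n W \<Longrightarrow> orthonormal_mat n (transpose_mat W)"
  unfolding orthonormal_mat_def by auto

lemma orthonormal_mat_mult:
  assumes "orthonormal_mat n U" "orthonormal_mat n W"
  shows "orthonormal_mat n (U * W)"
proof (rule orthonormal_matI)
  note U = orthonormal_matD[OF assms(1)] and W = orthonormal_matD[OF assms(2)]
  show "U * W \<in> carrier_mat n n" using U(1) W(1) by auto
  have "U * W * transpose_mat (U * W) = U * (W * transpose_mat W) * transpose_mat U"
    using U(1,2) W(1,2)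
    by (simp add: transpose_mult[of _ n n _ n] assoc_mult_mat[of _ n n _ n _ n])
  also have "\<dots> = 1\<^sub>m n" using U W by simp
  finally show "U * W * transpose_mat (U * W) = 1\<^sub>m n" .
qed

lemma sq_norm_orthonormal_mult:
  assumes "orthonormal_mat n U" "v \<in> carrier_vec n"
  shows "(U *\<^sub>v v) \<bullet> (U *\<^sub>v v) = v \<bullet> v"
proof -
  note U = orthonormal_matD[OF assms(1)]
  have "(U *\<^sub>v v) \<bullet> (U *\<^sub>v v) = (transpose_mat U *\<^sub>v (U *\<^sub>v v)) \<bullet> v"
    using U(1) assms(2) by (intro transpose_vec_mult_scalar[symmetric]) auto
  also have "transpose_mat U *\<^sub>v (U *\<^sub>v v) = transpose_mat U * U *\<^sub>v v"
    using U(1,2) assms(2) by (simp add: assoc_mult_mat_vec[of _ n n _ n])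
  finally show ?thesis using U assms(2) by simp
qed

section \<open>Eigenvectors of real symmetric matrices\<close>

lemma real_scalar_prod_self:
  "(v :: real vec) \<bullet> v = (\<Sum>i<dim_vec v. (v $ i)\<^sup>2)"
  by (simp add: scalar_prod_def power2_eq_square lessThan_atLeast0)

lemma real_scalar_prod_self_nonneg: "(v :: real vec) \<bullet> v \<ge> 0"
  by (simp add: real_scalar_prod_self sum_nonneg)

lemma real_scalar_prod_self_eq_0:
  assumes "(v :: real vec) \<in> carrier_vec n"
  shows "v \<bullet> v = 0 \<longleftrightarrow> v = 0\<^sub>v n"
  using assms by (auto simp: real_scalar_prod_self sum_nonneg_eq_0_iff intro!: eq_vecI)

text \<open>Over the complex numbers an eigenvector x + i y for some k exists. Its real and
  imaginary parts satisfy a coupled real system, and symmetry of \<open>A\<close> forces Im k = 0;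
  then whichever of x and y is nonzero is a real eigenvector.\<close>

lemma symmetric_mat_eigenvalue:
  assumes A: "A \<in> carrier_mat n n" and sym: "symmetric_mat A" and n: "n > 0"
  obtains \<mu> u where "u \<in> carrier_vec n" "u \<bullet> u = 1" "A *\<^sub>v u = \<mu> \<cdot>\<^sub>v u"
proof -
  define A' :: "complex mat" where "A' = map_mat of_real A"
  have A': "A' \<in> carrier_mat n n" using A by (auto simp: A'_def)
  from spectrum_non_empty[OF A' n] obtain k v where
    v: "v \<in> carrier_vec n" "v \<noteq> 0\<^sub>v n" and ev: "A' *\<^sub>v v = k \<cdot>\<^sub>v v"
    using A' unfolding spectrum_def eigenvalue_def eigenvector_def by auto
  define x y where "x = map_vec Re v" and "y = map_vec Im v"
  have xy: "x \<in> carrier_vec n" "y \<in> carrier_vec n" using v by (auto simp: x_def y_def)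
  have Ax: "A *\<^sub>v x = Re k \<cdot>\<^sub>v x - Im k \<cdot>\<^sub>v y"
  proof (rule eq_vecI)
    fix i assume "i < dim_vec (Re k \<cdot>\<^sub>v x - Im k \<cdot>\<^sub>v y)"
    then have i: "i < n" using xy by auto
    have "Re ((A' *\<^sub>v v) $ i) = Re ((k \<cdot>\<^sub>v v) $ i)" by (simp add: ev)
    then show "(A *\<^sub>v x) $ i = (Re k \<cdot>\<^sub>v x - Im k \<cdot>\<^sub>v y) $ i"
      using i A v(1) xy by (simp add: A'_def x_def y_def scalar_prod_def)
  qed (use A xy in auto)
  have Ay: "A *\<^sub>v y = Re k \<cdot>\<^sub>v y + Im k \<cdot>\<^sub>v x"
  proof (rule eq_vecI)
    fix i assume "i < dim_vec (Re k \<cdot>\<^sub>v y + Im k \<cdot>\<^sub>v x)"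
    then have i: "i < n" using xy by auto
    have "Im ((A' *\<^sub>v v) $ i) = Im ((k \<cdot>\<^sub>v v) $ i)" by (simp add: ev)
    then show "(A *\<^sub>v y) $ i = (Re k \<cdot>\<^sub>v y + Im k \<cdot>\<^sub>v x) $ i"
      using i A v(1) xy by (simp add: A'_def x_def y_def scalar_prod_def)
  qed (use A xy in auto)
  have "(A *\<^sub>v x) \<bullet> y = x \<bullet> (A *\<^sub>v y)"
    using transpose_vec_mult_scalar[of A n n y x] A xy sym
    by (metis comm_scalar_prod mult_mat_vec_carrier symmetric_mat_def)
  \<comment> \<open>The left side is Re k (x, y) - Im k (y, y) and the right side is Re k (x, y) +
    Im k (x, x).\<close>
  then have "Im k * (x \<bullet> x + y \<bullet> y) = 0"
    unfolding Ax Ay using xy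
    by (simp add: minus_scalar_prod_distrib[of _ n] scalar_prod_add_distrib[of _ n] algebra_simps
        comm_scalar_prod[of x n y])
  moreover have "x \<bullet> x + y \<bullet> y \<noteq> 0"
  proof
    assume "x \<bullet> x + y \<bullet> y = 0"
    then have "x = 0\<^sub>v n" "y = 0\<^sub>v n"
      using real_scalar_prod_self_nonneg[of x] real_scalar_prod_self_nonneg[of y] xy
      by (auto simp: real_scalar_prod_self_eq_0[symmetric])
    then have "v = 0\<^sub>v n"
      using v(1) by (auto simp: x_def y_def vec_eq_iff complex_eq_iff)
    with v show False by simp
  qed
  ultimately have k: "Im k = 0" by simp
  obtain w where w: "w \<in> carrier_vec n" "w \<noteq> 0\<^sub>v n" "A *\<^sub>v w = Re k \<cdot>\<^sub>v w"
  proof (cases "x = 0\<^sub>v n")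
    case False
    moreover have "A *\<^sub>v x = Re k \<cdot>\<^sub>v x" unfolding Ax k using xy by (intro eq_vecI) auto
    ultimately show ?thesis using that[of x] xy by auto
  next
    case True
    then have "y \<noteq> 0\<^sub>v n" using \<open>x \<bullet> x + y \<bullet> y \<noteq> 0\<close> xy by auto
    moreover have "A *\<^sub>v y = Re k \<cdot>\<^sub>v y" unfolding Ay k using xy by (intro eq_vecI) auto
    ultimately show ?thesis using that[of y] xy by auto
  qed
  define c where "c = w \<bullet> w"
  have c: "c > 0" using w real_scalar_prod_self_nonneg[of w] real_scalar_prod_self_eq_0[OF w(1)]
    by (simp add: c_def order_less_le)
  show ?thesis
  proof (rule that[of "(1 / sqrt c) \<cdot>\<^sub>v w"])
    show "((1 / sqrt c) \<cdot>\<^sub>v w) \<bullet> ((1 / sqrt c) \<cdot>\<^sub>v w) = 1"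
      using c w(1) by (simp add: c_def[symmetric])
    show "A *\<^sub>v ((1 / sqrt c) \<cdot>\<^sub>v w) = Re k \<cdot>\<^sub>v ((1 / sqrt c) \<cdot>\<^sub>v w)"
      using A w by (simp add: mult_mat_vec[of A n n] smult_smult_assoc mult.commute)
  qed (use w in auto)
qed

text \<open>Householder reflection; if \<open>u\<close> is the first unit vector then \<open>c = 2 / 0 = 0\<close> gives the identity.\<close>

lemma orthonormal_mat_with_col_0:
  fixes u :: "real vec"
  assumes u: "u \<in> carrier_vec n" "u \<bullet> u = 1" and n: "n > 0"
  obtains W where "orthonormal_mat n W" "col W 0 = u"
proof -
  define w where "w i = u $ i - (if i = 0 then 1 else 0)" for i
  define S where "S = (\<Sum>k<n. (w k)\<^sup>2)"
  define c where "c = 2 / S"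
  define W where "W = mat n n (\<lambda>(i, j). (if i = j then 1 else 0) - c * w i * w j)"
  have W: "W \<in> carrier_mat n n" by (simp add: W_def)
  have uu: "(\<Sum>k<n. (u $ k)\<^sup>2) = 1" using u by (simp add: real_scalar_prod_self)
  \<comment> \<open>Here w = u - e_0, and |u| = 1 gives |w|^2 = 2 - 2 u_0.\<close>
  have "S = (\<Sum>k<n. (u $ k)\<^sup>2 - (if k = 0 then 2 * u $ 0 - 1 else 0))"
    unfolding S_def w_def by (intro sum.cong) (auto simp: power2_eq_square algebra_simps)
  also have "\<dots> = 2 - 2 * u $ 0" using n by (simp add: sum_subtractf uu)
  finally have S: "S = 2 - 2 * u $ 0" .
  \<comment> \<open>The identity covers both cases, c S = 2 and c = 0. It makes the quadratic terms
    of W W^T cancel without a case distinction.\<close>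
  have cS: "c * (c * S - 2) = 0" by (simp add: c_def)
  have "W * transpose_mat W = 1\<^sub>m n"
  proof (rule eq_matI)
    fix i j assume "i < dim_row (1\<^sub>m n :: real mat)" "j < dim_col (1\<^sub>m n :: real mat)"
    then have ij: "i < n" "j < n" by auto
    have "(W * transpose_mat W) $$ (i, j) =
      (\<Sum>k<n. ((if i = k then 1 else 0) - c * w i * w k) * ((if j = k then 1 else 0) - c * w j * w k))"
      using ij by (simp add: W_def scalar_prod_def lessThan_atLeast0)
    also have "\<dots> = (\<Sum>k<n. (if i = k then (if i = j then 1 else 0) - c * w j * w k else 0)
        - (if j = k then c * w i * w k else 0) + c * c * w i * w j * (w k)\<^sup>2)"
      by (intro sum.cong) (auto simp: algebra_simps power2_eq_square)
    also have "\<dots> = (if i = j then 1 else 0) - c * w j * w i - c * w i * w j + c * c * w i * w j * S"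
      using ij by (simp add: sum.distrib sum_subtractf S_def sum_distrib_left)
    also have "\<dots> = (if i = j then 1 else 0) + w i * w j * (c * (c * S - 2))"
      by (simp add: algebra_simps)
    finally show "(W * transpose_mat W) $$ (i, j) = (1\<^sub>m n :: real mat) $$ (i, j)"
      using ij unfolding cS by simp
  qed (use W in auto)
  then have "orthonormal_mat n W" by (rule orthonormal_matI[OF W])
  moreover have "col W 0 = u"
  proof (rule eq_vecI)
    fix i assume "i < dim_vec u"
    then have i: "i < n" using u by auto
    have "W $$ (i, 0) = u $ i"
    proof (cases "S = 0")
      case True
      then have "w i = 0" using i by (auto simp: S_def sum_nonneg_eq_0_iff)
      then show ?thesis using True i n by (simp add: W_def c_def w_def)
    next
      case False
      \<comment> \<open>The formula for S says S = - 2 w_0, so column 0 of W is e_0 + w = u.\<close>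
      then have "c * w 0 = -1" by (simp add: c_def S w_def field_simps)
      then have "c * w i * w 0 = - w i" by (simp add: mult.assoc mult.left_commute[of _ "w i"])
      then show ?thesis using i n by (simp add: W_def w_def)
    qed
    then show "col W 0 $ i = u $ i" using i n W by simp
  qed (use W u in auto)
  ultimately show ?thesis by (rule that)
qed

lemma mat_diag_Suc:
  "mat_diag (Suc n) d = four_block_mat (mat 1 1 (\<lambda>_. d 0)) (0\<^sub>m 1 n) (0\<^sub>m n 1) (mat_diag n (\<lambda>i. d (Suc i)))"
  by (rule eq_matI) (auto simp: mat_diag_def)

lemma diag_block_mult:
  fixes A B :: "real mat"
  assumes "A \<in> carrier_mat k k" "B \<in> carrier_mat k k" "C \<in> carrier_mat n n" "D \<in> carrier_mat n n"
  shows "four_block_mat A (0\<^sub>m k n) (0\<^sub>m n k) C * four_block_mat B (0\<^sub>m k n) (0\<^sub>m n k) D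
    = four_block_mat (A * B) (0\<^sub>m k n) (0\<^sub>m n k) (C * D)"
proof -
  have eqs: "A * B + 0\<^sub>m k n * 0\<^sub>m n k = A * B" "A * 0\<^sub>m k n + 0\<^sub>m k n * D = 0\<^sub>m k n"
    "0\<^sub>m n k * B + C * 0\<^sub>m n k = 0\<^sub>m n k" "0\<^sub>m n k * 0\<^sub>m k n + C * D = C * D"
    using assms mult_square_mat_carrier[OF assms(1,2)] mult_square_mat_carrier[OF assms(3,4)]
    by (simp_all add: left_mult_zero_mat[of _ k] left_mult_zero_mat[of _ n]
        right_mult_zero_mat[of _ k k] right_mult_zero_mat[of _ n n])
  show ?thesis
    unfolding mult_four_block_mat[OF assms(1) zero_carrier_mat zero_carrier_mat assms(3)
        assms(2) zero_carrier_mat zero_carrier_mat assms(4)] eqs by (rule refl)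
qed

text \<open>Deflation: conjugating by an orthonormal matrix whose column 0 is an eigenvector clears
  column 0 below the diagonal, by symmetry also row 0, and leaves a symmetric block of size n for
  the induction.\<close>

theorem symmetric_mat_diagonalizable:
  assumes "A \<in> carrier_mat n n" "symmetric_mat A"
  shows "\<exists>V d. orthonormal_mat n V \<and> A = V * mat_diag n d * transpose_mat V"
  using assms
proof (induction n arbitrary: A)
  case 0
  have "orthonormal_mat 0 (1\<^sub>m 0)" by (simp add: orthonormal_mat_def)
  moreover have "A = 1\<^sub>m 0 * mat_diag 0 (\<lambda>_. 0) * transpose_mat (1\<^sub>m 0)"
    using 0 by (intro eq_matI) auto
  ultimately show ?case by blast
next
  case (Suc n)
  note A = Suc.prems(1)
  obtain \<mu> u where u: "u \<in> carrier_vec (Suc n)" "u \<bullet> u = 1" "A *\<^sub>v u = \<mu> \<cdot>\<^sub>v u"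
    by (rule symmetric_mat_eigenvalue[OF Suc.prems zero_less_Suc])
  obtain W where oW: "orthonormal_mat (Suc n) W" and W0: "col W 0 = u"
    using orthonormal_mat_with_col_0[OF u(1,2)] by auto
  note W = orthonormal_matD[OF oW]
  note assoc = assoc_mult_mat[of _ "Suc n" "Suc n" _ "Suc n" _ "Suc n"]
  define A' where "A' = transpose_mat W * A * W"
  have A': "A' \<in> carrier_mat (Suc n) (Suc n)" using A W by (auto simp: A'_def)
  have sym: "transpose_mat A' = A'"
    using A W Suc.prems(2) unfolding A'_def symmetric_mat_def
    by (simp add: transpose_mult[of _ "Suc n" "Suc n" _ "Suc n"] assoc)
  have AA': "A = W * A' * transpose_mat W"
  proof -
    have "W * A' * transpose_mat W = (W * transpose_mat W) * A * (W * transpose_mat W)"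
      using A W(1,2) unfolding A'_def by (simp add: assoc)
    then show ?thesis using A W by simp
  qed
  have "col A' 0 = transpose_mat W *\<^sub>v (A *\<^sub>v u)"
  proof -
    have "A' = transpose_mat W * (A * W)" using A W(1,2) by (simp add: A'_def assoc)
    then show ?thesis
      by (simp only: col_mult2[OF W(2) mult_square_mat_carrier[OF A W(1)] zero_less_Suc]
          col_mult2[OF A W(1) zero_less_Suc] W0)
  qed
  also have "\<dots> = \<mu> \<cdot>\<^sub>v (transpose_mat W *\<^sub>v col W 0)"
    using W(2) u(1) unfolding u(3) W0 by (rule mult_mat_vec)
  also have "transpose_mat W *\<^sub>v col W 0 = col (transpose_mat W * W) 0"
    by (rule col_mult2[symmetric, OF W(2,1) zero_less_Suc])
  also have "\<dots> = unit_vec (Suc n) 0" by (simp add: W(3))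
  finally have col0: "col A' 0 = \<mu> \<cdot>\<^sub>v unit_vec (Suc n) 0" .
  have A'col: "A' $$ (i, 0) = (if i = 0 then \<mu> else 0)" if "i < Suc n" for i
    using arg_cong[OF col0, of "\<lambda>v. v $ i"] that A' by auto
  have A'row: "A' $$ (0, i) = (if i = 0 then \<mu> else 0)" if "i < Suc n" for i
    using A'col[OF that] arg_cong[OF sym, of "\<lambda>X. X $$ (0, i)"] that A' by auto
  define A3 where "A3 = mat n n (\<lambda>(i, j). A' $$ (Suc i, Suc j))"
  have A3: "A3 \<in> carrier_mat n n" by (simp add: A3_def)
  have "symmetric_mat A3"
    unfolding symmetric_mat_def
  proof (rule eq_matI)
    fix i j assume "i < dim_row A3" "j < dim_col A3"
    then show "transpose_mat A3 $$ (i, j) = A3 $$ (i, j)"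
      using arg_cong[OF sym, of "\<lambda>X. X $$ (Suc i, Suc j)"] A' by (auto simp: A3_def)
  qed (auto simp: A3_def)
  from Suc.IH[OF A3 this] obtain V d where
    oV: "orthonormal_mat n V" and VA3: "A3 = V * mat_diag n d * transpose_mat V" by blast
  note V = orthonormal_matD[OF oV]
  define V' where "V' = four_block_mat (1\<^sub>m 1) (0\<^sub>m 1 n) (0\<^sub>m n 1) V"
  define D where "D = mat_diag (Suc n) (case_nat \<mu> d)"
  have V': "V' \<in> carrier_mat (Suc n) (Suc n)" and D: "D \<in> carrier_mat (Suc n) (Suc n)"
    using V(1) by (auto simp: V'_def D_def)
  have tV': "transpose_mat V' = four_block_mat (1\<^sub>m 1) (0\<^sub>m 1 n) (0\<^sub>m n 1) (transpose_mat V)"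
    unfolding V'_def using V(1) by (subst transpose_four_block_mat) auto
  have "V' * transpose_mat V' = four_block_mat (1\<^sub>m 1) (0\<^sub>m 1 n) (0\<^sub>m n 1) (1\<^sub>m n)"
    unfolding tV' unfolding V'_def using V(1,2,4) by (simp add: diag_block_mult)
  then have oV': "orthonormal_mat (Suc n) V'"
    by (intro orthonormal_matI V') simp
  have "A' = four_block_mat (mat 1 1 (\<lambda>_. \<mu>)) (0\<^sub>m 1 n) (0\<^sub>m n 1) A3"
    using A' by (intro eq_matI) (auto simp: A3_def A'row A'col)
  also have "\<dots> = V' * D * transpose_mat V'"
    unfolding tV' unfolding V'_def D_def mat_diag_Suc VA3 using V(1,2)
    by (simp add: diag_block_mult)
  finally have A'eq: "A' = V' * D * transpose_mat V'" .
  have "A = (W * V') * D * transpose_mat (W * V')"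
    unfolding AA' A'eq using W(1,2) V' D
    by (simp add: transpose_mult[of _ "Suc n" "Suc n" _ "Suc n"] assoc)
  then show ?case
    using orthonormal_mat_mult[OF oW oV'] D_def by blast
qed

section \<open>Functions of a diagonalized matrix\<close>

lemma dim_mat_diag [simp]: "dim_row (mat_diag n d) = n" "dim_col (mat_diag n d) = n"
  by (simp_all add: mat_diag_def)

lemma index_mat_diag_mult_vec:
  assumes "v \<in> carrier_vec n" "i < n"
  shows "(mat_diag n d *\<^sub>v v) $ i = d i * (v $ i :: real)"
proof -
  have "(mat_diag n d *\<^sub>v v) $ i = (\<Sum>k<n. (if i = k then d k else 0) * v $ k)"
    using assms by (simp add: mat_diag_def scalar_prod_def lessThan_atLeast0)
  also have "\<dots> = (\<Sum>k<n. if i = k then d k * v $ k else 0)" by (intro sum.cong) auto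
  finally show ?thesis using assms by simp
qed

lemma real_scalar_prod_mat_diag:
  fixes v :: "real vec"
  assumes "v \<in> carrier_vec n"
  shows "v \<bullet> (mat_diag n d *\<^sub>v v) = (\<Sum>i<n. d i * (v $ i)\<^sup>2)"
proof -
  have "v \<bullet> (mat_diag n d *\<^sub>v v) = (\<Sum>i<n. v $ i * (mat_diag n d *\<^sub>v v) $ i)"
    by (simp add: scalar_prod_def[of v] mat_diag_def lessThan_atLeast0)
  also have "\<dots> = (\<Sum>i<n. d i * (v $ i)\<^sup>2)"
    by (intro sum.cong refl, subst index_mat_diag_mult_vec[OF assms]) (auto simp: power2_eq_square)
  finally show ?thesis .
qed

lemma transpose_mat_diag: "transpose_mat (mat_diag n d) = mat_diag n d"
  by (rule eq_matI) (auto simp: mat_diag_def)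

text \<open>A functional calculus for one fixed eigenbasis: with \<open>W\<close> orthonormal, sums,
  products and scalings act pointwise on \<open>d\<close>. G, H, the inverse of H and the cutoffs of
  that inverse thus become computations with real eigenvalues.\<close>

definition conj_diag :: "nat \<Rightarrow> real mat \<Rightarrow> (nat \<Rightarrow> real) \<Rightarrow> real mat" where
  "conj_diag n W d = W * mat_diag n d * transpose_mat W"

lemma conj_diag_carrier [simp]: "W \<in> carrier_mat n n \<Longrightarrow> conj_diag n W d \<in> carrier_mat n n"
  by (simp add: conj_diag_def)

lemma transpose_conj_diag:
  "W \<in> carrier_mat n n \<Longrightarrow> transpose_mat (conj_diag n W d) = conj_diag n W d"
  by (simp add: conj_diag_def transpose_mult[of _ n n _ n] transpose_mat_diag assoc_mult_mat[of _ n n _ n _ n])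

lemma conj_diag_mult:
  assumes "orthonormal_mat n W"
  shows "conj_diag n W d * conj_diag n W e = conj_diag n W (\<lambda>i. d i * e i)"
proof -
  note W = orthonormal_matD[OF assms] and assoc = assoc_mult_mat[of _ n n _ n _ n]
  have "conj_diag n W d * conj_diag n W e
      = W * (mat_diag n d * (transpose_mat W * W) * mat_diag n e) * transpose_mat W"
    using W(1,2) by (simp add: conj_diag_def assoc)
  then show ?thesis using W by (simp add: conj_diag_def right_mult_one_mat')
qed

lemma conj_diag_const:
  assumes "orthonormal_mat n W"
  shows "conj_diag n W (\<lambda>_. c) = c \<cdot>\<^sub>m 1\<^sub>m n"
proof -
  note W = orthonormal_matD[OF assms]
  have "mat_diag n (\<lambda>_. c) = c \<cdot>\<^sub>m 1\<^sub>m n" by (rule eq_matI) (auto simp: mat_diag_def)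
  then show ?thesis
    using W by (simp add: conj_diag_def mult_smult_distrib[of _ n n _ n] mult_smult_assoc_mat[of _ n n _ n])
qed

lemma mat_diag_add: "mat_diag n d + mat_diag n e = mat_diag n (\<lambda>i. d i + e i :: real)"
  by (rule eq_matI) (auto simp: mat_diag_def)

lemma mat_diag_minus: "mat_diag n d - mat_diag n e = mat_diag n (\<lambda>i. d i - e i :: real)"
  by (rule eq_matI) (auto simp: mat_diag_def)

lemma mat_diag_smult: "c \<cdot>\<^sub>m mat_diag n d = mat_diag n (\<lambda>i. c * d i :: real)"
  by (rule eq_matI) (auto simp: mat_diag_def)

lemma conj_diag_add:
  assumes "W \<in> carrier_mat n n"
  shows "conj_diag n W d + conj_diag n W e = conj_diag n W (\<lambda>i. d i + e i)"
  using assms by (simp add: conj_diag_def mat_diag_add[symmetric] add_mult_distrib_mat[of _ n n _ _ n]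
     mult_add_distrib_mat[of _ n n _ n])

lemma conj_diag_minus:
  assumes "W \<in> carrier_mat n n"
  shows "conj_diag n W d - conj_diag n W e = conj_diag n W (\<lambda>i. d i - e i)"
  using assms by (simp add: conj_diag_def mat_diag_minus[symmetric] minus_mult_distrib_mat[of _ n n _ _ n]
     mult_minus_distrib_mat[of _ n n _ n])

lemma conj_diag_smult:
  assumes "W \<in> carrier_mat n n"
  shows "c \<cdot>\<^sub>m conj_diag n W d = conj_diag n W (\<lambda>i. c * d i)"
  using assms by (simp add: conj_diag_def mat_diag_smult[symmetric] mult_smult_distrib[of _ n n _ n] 
     mult_smult_assoc_mat[of _ n n _ n])

lemma conj_diag_cong: "(\<And>i. i < n \<Longrightarrow> d i = e i) \<Longrightarrow> conj_diag n W d = conj_diag n W e"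
  unfolding conj_diag_def mat_diag_def by (intro arg_cong2[of _ _ _ _ "(*)"] refl cong_mat) auto

lemma conj_diag_quadratic_form:
  assumes "W \<in> carrier_mat n n" "v \<in> carrier_vec n"
  shows "v \<bullet> (conj_diag n W d *\<^sub>v v) = (\<Sum>i<n. d i * ((transpose_mat W *\<^sub>v v) $ i)\<^sup>2)"
proof -
  have "v \<bullet> (conj_diag n W d *\<^sub>v v) = v \<bullet> (W *\<^sub>v (mat_diag n d *\<^sub>v (transpose_mat W *\<^sub>v v)))"
    using assms by (simp add: conj_diag_def assoc_mult_mat_vec[of _ n n _ n])
  also have "\<dots> = (transpose_mat W *\<^sub>v v) \<bullet> (mat_diag n d *\<^sub>v (transpose_mat W *\<^sub>v v))"
    using assms by (intro transpose_vec_mult_scalar[symmetric]) auto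
  finally show ?thesis using assms by (simp add: real_scalar_prod_mat_diag)
qed

lemma conj_diag_sym_pos_semidef:
  assumes "W \<in> carrier_mat n n" "\<And>i. i < n \<Longrightarrow> 0 \<le> d i"
  shows "sym_pos_semidef n (conj_diag n W d)"
  unfolding sym_pos_semidef_def symmetric_mat_def
  using assms by (auto simp: transpose_conj_diag conj_diag_quadratic_form intro!: sum_nonneg mult_nonneg_nonneg)

text \<open>Uniqueness: with \<open>Y\<close> the conjugate of \<open>X\<close> by \<open>W\<close> and \<open>S = diag s\<close>, \<open>Y\<^sup>2 = S\<^sup>2\<close> gives
  \<open>Y (Y - S) + (Y - S) S = 0\<close>, so each column \<open>v\<close> of \<open>Y - S\<close> satisfies
  \<open>Y v + s\<^sub>j v = 0\<close> and vanishes.\<close>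

lemma sqrt_mat_conj_diag:
  assumes oW: "orthonormal_mat n W" and s: "\<And>i. i < n \<Longrightarrow> 0 < s i"
  shows "sqrt_mat (conj_diag n W (\<lambda>i. (s i)\<^sup>2)) = conj_diag n W s"
proof -
  note W = orthonormal_matD[OF oW] and assoc = assoc_mult_mat[of _ n n _ n _ n]
  have dim: "dim_row (conj_diag n W (\<lambda>i. (s i)\<^sup>2)) = n" using W(1) by (simp add: conj_diag_def)
  show ?thesis
    unfolding sqrt_mat_def dim
  proof (rule the_equality, goal_cases)
    case 1
    show ?case using conj_diag_sym_pos_semidef[OF W(1), of s] s
      by (auto simp: conj_diag_mult[OF oW] power2_eq_square less_imp_le)
  next
    case (2 X)
    then have X: "X \<in> carrier_mat n n" and Xpos: "\<And>v. v \<in> carrier_vec n \<Longrightarrow> v \<bullet> (X *\<^sub>v v) \<ge> 0"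
      and XX: "X * X = conj_diag n W (\<lambda>i. (s i)\<^sup>2)" unfolding sym_pos_semidef_def by auto
    define Y where "Y = transpose_mat W * X * W"
    define S where "S = mat_diag n s"
    have Y: "Y \<in> carrier_mat n n" and S: "S \<in> carrier_mat n n"
      using X W(1,2) by (auto simp: Y_def S_def)
    have "Y * Y = transpose_mat W * X * (W * transpose_mat W) * X * W"
      using X W(1,2) by (simp add: Y_def assoc)
    also have "\<dots> = transpose_mat W * (X * X) * W" using X W by (simp add: assoc)
    also have "\<dots> = (transpose_mat W * W) * mat_diag n (\<lambda>i. (s i)\<^sup>2) * (transpose_mat W * W)"
      unfolding XX conj_diag_def using W(1,2) by (simp add: assoc)
    also have "\<dots> = S * S" using W by (simp add: S_def power2_eq_square left_mult_one_mat' right_mult_one_mat')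
    finally have YY: "Y * Y = S * S" .
    define D where "D = Y - S"
    have D: "D \<in> carrier_mat n n" using Y S by (auto simp: D_def)
    have YD: "Y * D = - (D * S)"
      using Y S unfolding D_def
      by (simp add: mult_minus_distrib_mat[of _ n n _ n] minus_mult_distrib_mat[of _ n n _ _ n] YY)
        (intro eq_matI; simp)
    have col0: "col D j = 0\<^sub>v n" if j: "j < n" for j
    proof -
      define v where "v = col D j"
      have v: "v \<in> carrier_vec n" using D by (auto simp: v_def)
      have "Y *\<^sub>v v = col (Y * D) j" unfolding v_def by (rule col_mult2[symmetric, OF Y D j])
      also have "\<dots> = - s j \<cdot>\<^sub>v v"
        unfolding YD using D j
        by (intro eq_vecI) (auto simp: v_def S_def mat_diag_mult_right[of _ n])
      finally have Yv: "Y *\<^sub>v v = - s j \<cdot>\<^sub>v v" .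
      have "v \<bullet> (Y *\<^sub>v v) = v \<bullet> (transpose_mat W *\<^sub>v (X *\<^sub>v (W *\<^sub>v v)))"
        using X W(1,2) v by (simp add: Y_def assoc_mult_mat_vec[of _ n n _ n])
      also have "\<dots> = (W *\<^sub>v v) \<bullet> (X *\<^sub>v (W *\<^sub>v v))"
        using transpose_vec_mult_scalar[OF W(2), of "X *\<^sub>v (W *\<^sub>v v)" v] X W(1) v by simp
      also have "\<dots> \<ge> 0" using Xpos W(1) v by auto
      finally have "s j * (v \<bullet> v) \<le> 0" using v by (simp add: Yv)
      then have "v \<bullet> v = 0"
        using s[OF j] real_scalar_prod_self_nonneg[of v] by (simp add: mult_le_0_iff)
      then show ?thesis using v by (simp add: v_def real_scalar_prod_self_eq_0)
    qed
    have "Y = S"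
    proof (rule eq_matI)
      fix i j assume "i < dim_row S" "j < dim_col S"
      then have ij: "i < n" "j < n" using S by auto
      then show "Y $$ (i, j) = S $$ (i, j)"
        using arg_cong[OF col0[OF ij(2)], of "\<lambda>v. v $ i"] Y S by (simp add: D_def)
    qed (use Y S in auto)
    moreover have "X = (W * transpose_mat W) * X * (W * transpose_mat W)"
      using X W by simp
    then have "X = W * Y * transpose_mat W"
      using X W(1,2) by (simp add: Y_def assoc)
    ultimately show ?case by (simp add: S_def conj_diag_def)
  qed
qed

section \<open>Inverses and operator norm bounds\<close>

lemma inv_mat_eqI:
  assumes "A \<in> carrier_mat n n" "B \<in> carrier_mat n n" "A * B = 1\<^sub>m n" "B * A = 1\<^sub>m n"
  shows "inv_mat A = B"
proof (cases "mat_inverse A")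
  case None
  \<comment> \<open>The last argument of \<open>ring_mat\<close> fills the extension slot of the
    ring record and may be any value.\<close>
  then have "A \<notin> Units (ring_mat TYPE(real) n (undefined :: unit))" by (rule mat_inverse(1)[OF assms(1)])
  moreover have "A \<in> Units (ring_mat TYPE(real) n (undefined :: unit))"
    using assms by (auto simp: Units_def ring_mat_def)
  ultimately show ?thesis by simp
next
  case (Some C)
  note C = mat_inverse(2)[OF assms(1) Some]
  have "C = C * (A * B)" using assms C by (simp add: right_mult_one_mat[of C n n])
  also have "\<dots> = (C * A) * B" using assms C by (intro assoc_mult_mat[symmetric, of _ n n _ n _ n]) auto
  also have "C * A = 1\<^sub>m n" using C by simp
  also have "1\<^sub>m n * B = B" using assms by simp
  finally show ?thesis using Some by (simp add: inv_mat_def)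
qed

text \<open>Squared norms avoid square roots, and the parallelogram bound for differences avoids the
  triangle inequality.\<close>

definition norm_bounded :: "nat \<Rightarrow> real \<Rightarrow> real mat \<Rightarrow> bool" where
  "norm_bounded n c A \<longleftrightarrow> A \<in> carrier_mat n n \<and>
     (\<forall>v \<in> carrier_vec n. (A *\<^sub>v v) \<bullet> (A *\<^sub>v v) \<le> c\<^sup>2 * (v \<bullet> v))"

lemma norm2_mat_le:
  assumes "norm_bounded n c A" "0 < n" "0 \<le> c"
  shows "norm2_mat A \<le> c"
  unfolding norm2_mat_def
proof (rule cSUP_least)
  \<comment> \<open>A real supremum is bounded through \<open>cSUP_least\<close> only over a
    nonempty set; 0 < n supplies a unit vector.\<close>
  have "unit_vec n 0 \<in> {v \<in> carrier_vec (dim_col A). norm2_vec v = 1}"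
    using assms by (auto simp: norm2_vec_def norm_bounded_def)
  then show "{v \<in> carrier_vec (dim_col A). norm2_vec v = 1} \<noteq> {}" by blast
  fix v assume "v \<in> {v \<in> carrier_vec (dim_col A). norm2_vec v = 1}"
  then have "v \<in> carrier_vec n" "v \<bullet> v = 1"
    using assms(1) by (auto simp: norm2_vec_def norm_bounded_def)
  then have "(A *\<^sub>v v) \<bullet> (A *\<^sub>v v) \<le> c\<^sup>2" using assms(1) by (auto simp: norm_bounded_def)
  then show "norm2_vec (A *\<^sub>v v) \<le> c"
    unfolding norm2_vec_def using assms(3) by (simp add: real_le_lsqrt)
qed

lemma norm_bounded_orthonormal: "orthonormal_mat n U \<Longrightarrow> norm_bounded n 1 U"
  by (auto simp: norm_bounded_def sq_norm_orthonormal_mult orthonormal_mat_def)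

lemma norm_bounded_mult:
  assumes "norm_bounded n c A" "norm_bounded n d B"
  shows "norm_bounded n (c * d) (A * B)"
  unfolding norm_bounded_def
proof (intro conjI ballI)
  have A: "A \<in> carrier_mat n n" and B: "B \<in> carrier_mat n n"
    using assms by (auto simp: norm_bounded_def)
  then show "A * B \<in> carrier_mat n n" by simp
  fix v :: "real vec" assume v: "v \<in> carrier_vec n"
  have "(A * B *\<^sub>v v) \<bullet> (A * B *\<^sub>v v) \<le> c\<^sup>2 * ((B *\<^sub>v v) \<bullet> (B *\<^sub>v v))"
    using assms(1) A B v by (simp add: norm_bounded_def assoc_mult_mat_vec[of _ n n _ n])
  also have "\<dots> \<le> c\<^sup>2 * (d\<^sup>2 * (v \<bullet> v))"
    using assms(2) v by (intro mult_left_mono) (auto simp: norm_bounded_def)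
  finally show "(A * B *\<^sub>v v) \<bullet> (A * B *\<^sub>v v) \<le> (c * d)\<^sup>2 * (v \<bullet> v)"
    by (simp add: power_mult_distrib)
qed

lemma norm_bounded_diff:
  assumes "norm_bounded n c A" "norm_bounded n c B"
  shows "norm_bounded n (2 * c) (A - B)"
  unfolding norm_bounded_def
proof (intro conjI ballI)
  have A: "A \<in> carrier_mat n n" and B: "B \<in> carrier_mat n n"
    using assms by (auto simp: norm_bounded_def)
  then show "A - B \<in> carrier_mat n n" by (simp add: minus_carrier_mat)
  fix v :: "real vec" assume v: "v \<in> carrier_vec n"
  define x y where "x = A *\<^sub>v v" and "y = B *\<^sub>v v"
  have xy: "x \<in> carrier_vec n" "y \<in> carrier_vec n" using A B v by (auto simp: x_def y_def)
  have "(\<Sum>i<n. (x $ i - y $ i)\<^sup>2 + (x $ i + y $ i)\<^sup>2) = (\<Sum>i<n. 2 * (x $ i)\<^sup>2 + 2 * (y $ i)\<^sup>2)"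
    by (intro sum.cong refl) (simp add: power2_eq_square algebra_simps)
  then have "(x - y) \<bullet> (x - y) + (x + y) \<bullet> (x + y) = 2 * (x \<bullet> x) + 2 * (y \<bullet> y)"
    using xy by (simp add: real_scalar_prod_self sum.distrib sum_distrib_left)
  then have "(x - y) \<bullet> (x - y) \<le> 2 * (x \<bullet> x) + 2 * (y \<bullet> y)"
    using real_scalar_prod_self_nonneg[of "x + y"] by simp
  \<comment> \<open>With equal bounds c for both matrices, 2 c^2 + 2 c^2 = (2 c)^2, so the
    parallelogram estimate gives the same constant as the triangle inequality.\<close>
  also have "\<dots> \<le> (2 * c)\<^sup>2 * (v \<bullet> v)"
    using assms v unfolding norm_bounded_def x_def y_def by (fastforce simp: power_mult_distrib)
  finally show "((A - B) *\<^sub>v v) \<bullet> ((A - B) *\<^sub>v v) \<le> (2 * c)\<^sup>2 * (v \<bullet> v)"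
    using A B v by (simp add: x_def y_def minus_mult_distrib_mat_vec[of _ n n])
qed

lemma norm_bounded_conj_diag:
  assumes oW: "orthonormal_mat n W" and d: "\<And>i. i < n \<Longrightarrow> \<bar>d i\<bar> \<le> c"
  shows "norm_bounded n c (conj_diag n W d)"
proof -
  have "norm_bounded n c (mat_diag n d)"
    unfolding norm_bounded_def
  proof (intro conjI ballI)
    fix v :: "real vec" assume v: "v \<in> carrier_vec n"
    have "(mat_diag n d *\<^sub>v v) \<bullet> (mat_diag n d *\<^sub>v v) = (\<Sum>i<n. (d i)\<^sup>2 * (v $ i)\<^sup>2)"
      unfolding real_scalar_prod_self
    proof (intro sum.cong)
      fix i assume "i \<in> {..<n}"
      then show "((mat_diag n d *\<^sub>v v) $ i)\<^sup>2 = (d i)\<^sup>2 * (v $ i)\<^sup>2"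
        by (subst index_mat_diag_mult_vec[OF v]) (simp_all add: power_mult_distrib)
    qed simp
    also have "\<dots> \<le> (\<Sum>i<n. c\<^sup>2 * (v $ i)\<^sup>2)"
      using d by (intro sum_mono mult_right_mono) (auto simp: abs_le_square_iff[symmetric] intro: order_trans[OF _ abs_ge_self])
    finally show "(mat_diag n d *\<^sub>v v) \<bullet> (mat_diag n d *\<^sub>v v) \<le> c\<^sup>2 * (v \<bullet> v)"
      using v by (simp add: real_scalar_prod_self sum_distrib_left)
  qed simp
  from norm_bounded_mult[OF norm_bounded_mult[OF norm_bounded_orthonormal[OF oW] this]
      norm_bounded_orthonormal[OF orthonormal_mat_transpose[OF oW]]]
  show ?thesis by (simp add: conj_diag_def)
qed

section \<open>Rank bounds by factorization\<close>

text \<open>Rank is bounded by a factorization through dimension \<open>r\<close>, so that sums,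
  products, transposes, blocks and Kronecker products are treated by combining factors. Only
  \<open>rank_le_rank\<close> returns to the dimension of the column space.\<close>

definition rank_le :: "nat \<Rightarrow> real mat \<Rightarrow> bool" where
  "rank_le r A \<longleftrightarrow> (\<exists>B C. B \<in> carrier_mat (dim_row A) r \<and> C \<in> carrier_mat r (dim_col A) \<and> A = B * C)"

lemma rank_leI:
  "B \<in> carrier_mat nr r \<Longrightarrow> C \<in> carrier_mat r nc \<Longrightarrow> A = B * C \<Longrightarrow> rank_le r A"
  unfolding rank_le_def by auto

lemma rank_leE:
  assumes "rank_le r A" "A \<in> carrier_mat nr nc"
  obtains B C where "B \<in> carrier_mat nr r" "C \<in> carrier_mat r nc" "A = B * C"
  using assms unfolding rank_le_def by auto

text \<open>B C is a sum of r products of a column with a row, each of rank at most 1. The induction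
  splits off the last of them and uses subadditivity of the rank.\<close>

lemma rank_le_rank:
  assumes "rank_le r A" "A \<in> carrier_mat nr nc"
  shows "vec_space.rank nr A \<le> r"
proof -
  have "vec_space.rank nr (B * C) \<le> r"
    if "B \<in> carrier_mat nr r" "C \<in> carrier_mat r nc" for B C :: "real mat"
    using that
  proof (induction r arbitrary: B C)
    case 0
    then have "B * C = 0\<^sub>m nr nc" by (intro eq_matI) (auto simp: scalar_prod_def)
    then show ?case by (simp add: vec_space.rank_0I)
  next
    case (Suc r)
    define B' where "B' = mat nr r (\<lambda>(i, j). B $$ (i, j))"
    define C' where "C' = mat r nc (\<lambda>(i, j). C $$ (i, j))"
    define D where "D = mat nr nc (\<lambda>(i, j). B $$ (i, r) * C $$ (r, j))"
    have "B * C = B' * C' + D"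
      using Suc.prems by (intro eq_matI) (auto simp: scalar_prod_def B'_def C'_def D_def)
    moreover have "vec_space.rank nr (B' * C' + D) \<le> vec_space.rank nr (B' * C') + vec_space.rank nr D"
      by (rule vec_space.rank_subadditive[of _ _ nc]) (auto simp: B'_def C'_def D_def)
    moreover have "vec_space.rank nr D \<le> 1"
      by (rule vec_space.rank_le_1_product_entries[of _ _ nc "\<lambda>i. B $$ (i, r)" "\<lambda>j. C $$ (r, j)"])
        (auto simp: D_def)
    moreover have "vec_space.rank nr (B' * C') \<le> r"
      by (rule Suc.IH) (auto simp: B'_def C'_def)
    ultimately show ?case by simp
  qed
  then show ?thesis using rank_leE[OF assms] by metis
qed

lemma rank_le_0: "rank_le 0 (0\<^sub>m nr nc)"
  by (rule rank_leI[of "0\<^sub>m nr 0" nr 0 "0\<^sub>m 0 nc" nc]) (auto simp: scalar_prod_def)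

lemma rank_le_add:
  assumes "rank_le r A" "rank_le s B" "A \<in> carrier_mat nr nc" "B \<in> carrier_mat nr nc"
  shows "rank_le (r + s) (A + B)"
proof -
  obtain A1 A2 where A: "A1 \<in> carrier_mat nr r" "A2 \<in> carrier_mat r nc" "A = A1 * A2"
    by (rule rank_leE[OF assms(1,3)])
  obtain B1 B2 where B: "B1 \<in> carrier_mat nr s" "B2 \<in> carrier_mat s nc" "B = B1 * B2"
    by (rule rank_leE[OF assms(2,4)])
  \<comment> \<open>Blocks without rows or columns turn \<open>four_block_mat\<close> into
    juxtaposition [A1 B1] and stacking of A2 over B2; the product of the two is A + B.\<close>
  let ?L = "four_block_mat A1 B1 (0\<^sub>m 0 r) (0\<^sub>m 0 s)"
  let ?R = "four_block_mat A2 (0\<^sub>m r 0) B2 (0\<^sub>m s 0)"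
  have "?L * ?R = four_block_mat (A + B) (0\<^sub>m nr 0) (0\<^sub>m 0 nc) (0\<^sub>m 0 0)"
    using A B by (subst mult_four_block_mat[of _ nr r _ s _ 0 _ _ nc _ 0]) auto
  also have "\<dots> = A + B" using assms(3,4) by (intro eq_matI) auto
  finally show ?thesis
    using A B by (intro rank_leI[of ?L nr _ ?R nc])
      (use four_block_carrier_mat[of A1 nr r "0\<^sub>m 0 s" 0 s] four_block_carrier_mat[of A2 r nc "0\<^sub>m s 0" s 0] in auto)
qed

lemma rank_le_mult_left:
  assumes "rank_le r A" "A \<in> carrier_mat n nc" "X \<in> carrier_mat nr n"
  shows "rank_le r (X * A)"
proof -
  obtain B C where "B \<in> carrier_mat n r" "C \<in> carrier_mat r nc" "A = B * C"
    by (rule rank_leE[OF assms(1,2)])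
  then show ?thesis using assms(3)
    by (intro rank_leI[of "X * B" nr r C nc]) auto
qed

lemma rank_le_mult_right:
  assumes "rank_le r A" "A \<in> carrier_mat nr n" "X \<in> carrier_mat n nc"
  shows "rank_le r (A * X)"
proof -
  obtain B C where "B \<in> carrier_mat nr r" "C \<in> carrier_mat r n" "A = B * C"
    by (rule rank_leE[OF assms(1,2)])
  then show ?thesis using assms(3)
    by (intro rank_leI[of B nr r "C * X" nc]) auto
qed

lemma rank_le_transpose:
  assumes "rank_le r A" "A \<in> carrier_mat nr nc"
  shows "rank_le r (transpose_mat A)"
proof -
  obtain B C where BC: "B \<in> carrier_mat nr r" "C \<in> carrier_mat r nc" "A = B * C"
    by (rule rank_leE[OF assms])
  show ?thesis
    by (rule rank_leI[of "transpose_mat C" nc r "transpose_mat B" nr])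
      (use BC in \<open>auto intro: transpose_mult\<close>)
qed

lemma rank_le_smult:
  assumes "rank_le r A" "A \<in> carrier_mat nr nc"
  shows "rank_le r (c \<cdot>\<^sub>m A)"
proof -
  obtain B C where BC: "B \<in> carrier_mat nr r" "C \<in> carrier_mat r nc" "A = B * C"
    by (rule rank_leE[OF assms])
  show ?thesis
    by (rule rank_leI[of "c \<cdot>\<^sub>m B" nr r C nc])
      (use BC in \<open>auto simp: mult_smult_assoc_mat\<close>)
qed

text \<open>Each row with index in \<open>S\<close> contributes a unit column times that row, a
  matrix of rank at most 1.\<close>

lemma rank_le_rows:
  assumes "A \<in> carrier_mat nr nc" "finite S"
    and "\<And>i j. i < nr \<Longrightarrow> j < nc \<Longrightarrow> i \<notin> S \<Longrightarrow> A $$ (i, j) = 0"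
  shows "rank_le (card S) A"
  using assms(2,1,3)
proof (induction S arbitrary: A rule: finite_induct)
  case empty
  then have "A = 0\<^sub>m nr nc" by (intro eq_matI) auto
  then show ?case using rank_le_0 by simp
next
  case (insert s S)
  define B where "B = mat nr nc (\<lambda>(i, j). if i = s then 0 else A $$ (i, j))"
  define C where "C = mat nr nc (\<lambda>(i, j). if i = s then A $$ (i, j) else 0)"
  have "rank_le (card S) B"
    by (rule insert.IH) (use insert.prems in \<open>auto simp: B_def\<close>)
  moreover have "rank_le 1 C"
    by (rule rank_leI[of "mat nr 1 (\<lambda>(i, _). if i = s then 1 else 0)" nr _
          "mat 1 nc (\<lambda>(_, j). A $$ (s, j))" nc])
      (auto simp: C_def scalar_prod_def intro!: eq_matI)
  ultimately have "rank_le (card S + 1) (B + C)"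
    by (rule rank_le_add[of _ _ _ _ nr nc]) (auto simp: B_def C_def)
  moreover have "B + C = A" using insert.prems(1) by (intro eq_matI) (auto simp: B_def C_def)
  ultimately show ?case using insert.hyps by simp
qed

text \<open>The block matrix is the column (P, Q) times X times the row (R, S), so it factors
  through the same dimension as X. With P, Q, R, S chosen among 0 and 1 this places X in one corner
  of a larger matrix at no cost in rank.\<close>

lemma rank_le_outer_block:
  assumes "rank_le r X" and X: "X \<in> carrier_mat n n"
    and PQ: "P \<in> carrier_mat n n" "Q \<in> carrier_mat n n"
    and RS: "R \<in> carrier_mat n n" "S \<in> carrier_mat n n"
  shows "rank_le r (four_block_mat (P * X * R) (P * X * S) (Q * X * R) (Q * X * S))"
proof -
  obtain B C where B: "B \<in> carrier_mat n r" and C: "C \<in> carrier_mat r n" and BC: "X = B * C"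
    by (rule rank_leE[OF assms(1) X])
  let ?L = "four_block_mat (P * B) (0\<^sub>m n 0) (Q * B) (0\<^sub>m n 0)"
  let ?R = "four_block_mat (C * R) (C * S) (0\<^sub>m 0 n) (0\<^sub>m 0 n)"
  have carr: "P * B \<in> carrier_mat n r" "Q * B \<in> carrier_mat n r" "C * R \<in> carrier_mat r n" "C * S \<in> carrier_mat r n"
    using B C PQ RS by auto
  have zero: "U + 0\<^sub>m n 0 * 0\<^sub>m 0 n = U" if "U \<in> carrier_mat n n" for U :: "real mat"
    using that by (intro eq_matI) (auto simp: scalar_prod_def)
  have assoc: "(U * B) * (C * V) = U * X * V" if "U \<in> carrier_mat n n" "V \<in> carrier_mat n n" for U V
    using that B C unfolding BC
    by (simp add: assoc_mult_mat[of _ n n _ r _ n] assoc_mult_mat[of _ n n _ n _ n] assoc_mult_mat[of _ n r _ n _ n])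
  have "?L * ?R = four_block_mat (P * X * R) (P * X * S) (Q * X * R) (Q * X * S)"
    using X PQ RS carr
    by (subst mult_four_block_mat[OF carr(1) zero_carrier_mat carr(2) zero_carrier_mat carr(3,4) zero_carrier_mat zero_carrier_mat])
      (simp add: assoc zero)
  then show ?thesis
    using four_block_carrier_mat[OF carr(1), of "0\<^sub>m n 0" n 0] four_block_carrier_mat[OF carr(3), of "0\<^sub>m 0 n" 0 n]
    by (intro rank_leI[of ?L "n + n" r ?R "n + n"]) auto
qed

lemma rank_le_four_block:
  assumes "rank_le r1 A" "rank_le r2 B" "rank_le r3 C" "rank_le r4 D"
    and A: "A \<in> carrier_mat n n" and B: "B \<in> carrier_mat n n"
    and C: "C \<in> carrier_mat n n" and D: "D \<in> carrier_mat n n"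
  shows "rank_le (r1 + r2 + r3 + r4) (four_block_mat A B C D)"
proof -
  let ?Z = "0\<^sub>m n n" and ?I = "1\<^sub>m n :: real mat"
  have "rank_le r1 (four_block_mat A ?Z ?Z ?Z)"
    using rank_le_outer_block[OF assms(1) A, of ?I ?Z ?I ?Z] A by simp
  moreover have "rank_le r2 (four_block_mat ?Z B ?Z ?Z)"
    using rank_le_outer_block[OF assms(2) B, of ?I ?Z ?Z ?I] B by simp
  moreover have "rank_le r3 (four_block_mat ?Z ?Z C ?Z)"
    using rank_le_outer_block[OF assms(3) C, of ?Z ?I ?I ?Z] C by simp
  moreover have "rank_le r4 (four_block_mat ?Z ?Z ?Z D)"
    using rank_le_outer_block[OF assms(4) D, of ?Z ?I ?Z ?I] D by simp
  ultimately have "rank_le (r1 + r2 + r3 + r4) (four_block_mat A ?Z ?Z ?Z + four_block_mat ?Z B ?Z ?Z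
    + four_block_mat ?Z ?Z C ?Z + four_block_mat ?Z ?Z ?Z D)"
    using A B C D by (auto intro!: rank_le_add[of _ _ _ _ "n + n" "n + n"])
  moreover have "four_block_mat A B C D = four_block_mat A ?Z ?Z ?Z + four_block_mat ?Z B ?Z ?Z
    + four_block_mat ?Z ?Z C ?Z + four_block_mat ?Z ?Z ?Z D"
    using A B C D by (intro eq_matI) auto
  ultimately show ?thesis by simp
qed

lemma rank_le_conj_diag:
  assumes W: "W \<in> carrier_mat n n" and "finite S" and "\<And>i. i < n \<Longrightarrow> i \<notin> S \<Longrightarrow> d i = 0"
  shows "rank_le (card S) (conj_diag n W d)"
proof -
  have "rank_le (card S) (mat_diag n d)"
    by (rule rank_le_rows[of _ n n]) (use assms in \<open>auto simp: mat_diag_def\<close>)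
  then show ?thesis
    unfolding conj_diag_def using W
    by (intro rank_le_mult_right[of _ _ n n _ n] rank_le_mult_left[of _ _ n n _ n]) auto
qed

section \<open>Kronecker products and the sine transform\<close>

lemma dim_kron [simp]:
  "dim_row (kron A B) = dim_row A * dim_row B" "dim_col (kron A B) = dim_col A * dim_col B"
  by (simp_all add: kron_def)

lemma kron_carrier [simp]:
  "A \<in> carrier_mat a b \<Longrightarrow> B \<in> carrier_mat c d \<Longrightarrow> kron A B \<in> carrier_mat (a * c) (b * d)"
  by (metis carrier_matD carrier_matI dim_kron)

lemma kron_index:
  "i < dim_row A * dim_row B \<Longrightarrow> j < dim_col A * dim_col B \<Longrightarrow>
   kron A B $$ (i, j) = A $$ (i div dim_row B, j div dim_col B) * B $$ (i mod dim_row B, j mod dim_col B)"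
  by (simp add: kron_def)

lemma div_mod_less_mult:
  assumes "i < a * (b :: nat)"
  shows "i div b < a" "i mod b < b"
proof -
  have "b > 0" using assms by (cases b) auto
  then show "i mod b < b" by simp
  show "i div b < a" using assms by (rule less_mult_imp_div_less)
qed

lemma sum_div_mod:
  fixes F :: "nat \<Rightarrow> nat \<Rightarrow> real"
  shows "(\<Sum>k<b * d. F (k div d) (k mod d)) = (\<Sum>p<b. \<Sum>q<d. F p q)"
proof -
  have "(\<Sum>k<b * d. F (k div d) (k mod d)) = (\<Sum>p<b. \<Sum>k=p * d..<p * d + d. F (k div d) (k mod d))"
    by (rule sum.nat_group[symmetric])
  also have "\<dots> = (\<Sum>p<b. \<Sum>q<d. F p q)"
  proof (rule sum.cong[OF refl])
    fix p
    have "(\<Sum>k=p * d..<p * d + d. F (k div d) (k mod d)) = (\<Sum>q<d. F ((p * d + q) div d) ((p * d + q) mod d))"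
      by (simp add: sum.atLeastLessThan_shift_0[of _ "p * d"] lessThan_atLeast0)
    also have "\<dots> = (\<Sum>q<d. F p q)" by (intro sum.cong) auto
    finally show "(\<Sum>k=p * d..<p * d + d. F (k div d) (k mod d)) = (\<Sum>q<d. F p q)" .
  qed
  finally show ?thesis .
qed

lemma kron_mult:
  assumes A: "A \<in> carrier_mat a b" and B: "B \<in> carrier_mat c d"
    and A': "A' \<in> carrier_mat b e" and B': "B' \<in> carrier_mat d f"
  shows "kron A B * kron A' B' = kron (A * A') (B * B')"
proof (rule eq_matI)
  fix i j assume "i < dim_row (kron (A * A') (B * B'))" "j < dim_col (kron (A * A') (B * B'))"
  then have ij: "i < a * c" "j < e * f" using A B A' B' by auto
  note lt = div_mod_less_mult[OF ij(1)] div_mod_less_mult[OF ij(2)]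
  have "(kron A B * kron A' B') $$ (i, j) = (\<Sum>k<b * d.
      (A $$ (i div c, k div d) * B $$ (i mod c, k mod d)) * (A' $$ (k div d, j div f) * B' $$ (k mod d, j mod f)))"
    using A B A' B' ij by (simp add: scalar_prod_def lessThan_atLeast0 kron_index)
  also have "\<dots> = (\<Sum>p<b. \<Sum>q<d.
      (A $$ (i div c, p) * B $$ (i mod c, q)) * (A' $$ (p, j div f) * B' $$ (q, j mod f)))"
    by (rule sum_div_mod)
  also have "\<dots> = (\<Sum>p<b. A $$ (i div c, p) * A' $$ (p, j div f)) * (\<Sum>q<d. B $$ (i mod c, q) * B' $$ (q, j mod f))"
    by (simp add: sum_product algebra_simps)
  also have "\<dots> = kron (A * A') (B * B') $$ (i, j)"
    using A B A' B' ij lt by (simp add: kron_index scalar_prod_def lessThan_atLeast0)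
  finally show "(kron A B * kron A' B') $$ (i, j) = kron (A * A') (B * B') $$ (i, j)" .
qed (use A B A' B' in auto)

lemma transpose_kron: "transpose_mat (kron A B) = kron (transpose_mat A) (transpose_mat B)"
  by (rule eq_matI) (auto simp: kron_index div_mod_less_mult)

lemma kron_mat_diag:
  "kron (mat_diag n d) (mat_diag m e) = mat_diag (n * m) (\<lambda>i. d (i div m) * e (i mod m))"
proof (rule eq_matI)
  fix i j
  assume "i < dim_row (mat_diag (n * m) (\<lambda>i. d (i div m) * e (i mod m)))"
    "j < dim_col (mat_diag (n * m) (\<lambda>i. d (i div m) * e (i mod m)))"
  then have ij: "i < n * m" "j < n * m" by auto
  have "i = j \<longleftrightarrow> i div m = j div m \<and> i mod m = j mod m"
    by (metis div_mult_mod_eq)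
  then show "kron (mat_diag n d) (mat_diag m e) $$ (i, j) = mat_diag (n * m) (\<lambda>i. d (i div m) * e (i mod m)) $$ (i, j)"
    using ij div_mod_less_mult[OF ij(1)] div_mod_less_mult[OF ij(2)]
    by (auto simp: kron_index mat_diag_def)
qed auto

lemma kron_one: "kron (1\<^sub>m n) (1\<^sub>m m) = 1\<^sub>m (n * m)"
  using kron_mat_diag[of n "\<lambda>_. 1" m "\<lambda>_. 1"] by simp

lemma kron_minus_left:
  "A \<in> carrier_mat a b \<Longrightarrow> B \<in> carrier_mat a b \<Longrightarrow> kron (A - B) C = kron A C - kron B C"
  by (rule eq_matI) (auto simp: kron_index div_mod_less_mult algebra_simps)

lemma orthonormal_mat_kron:
  assumes "orthonormal_mat n U" "orthonormal_mat m V"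
  shows "orthonormal_mat (n * m) (kron U V)"
  using orthonormal_matD[OF assms(1)] orthonormal_matD[OF assms(2)]
  by (intro orthonormal_matI) (simp_all add: transpose_kron kron_mult[of _ n n _ m m _ n _ m] kron_one)

lemma kron_conj_diag:
  assumes U: "U \<in> carrier_mat n n" and V: "V \<in> carrier_mat m m"
  shows "kron (conj_diag n U d) (conj_diag m V e) = conj_diag (n * m) (kron U V) (\<lambda>i. d (i div m) * e (i mod m))"
  using U V unfolding conj_diag_def kron_mat_diag[symmetric] transpose_kron
  by (simp add: kron_mult[of _ n n _ m m _ n _ m] assoc_mult_mat[of _ n n _ n _ n] assoc_mult_mat[of _ m m _ m _ m])

text \<open>If A = X Y then A (x) B = (X (x) I) (Y (x) B) with inner dimension r m. No rank
  information on \<open>B\<close> enters, so every unit of rank in the time factor costs m.\<close>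

lemma rank_le_kron:
  assumes "rank_le r A" "A \<in> carrier_mat n k" "B \<in> carrier_mat m m"
  shows "rank_le (r * m) (kron A B)"
proof -
  obtain X Y where XY: "X \<in> carrier_mat n r" "Y \<in> carrier_mat r k" "A = X * Y"
    by (rule rank_leE[OF assms(1,2)])
  show ?thesis
    by (rule rank_leI[of "kron X (1\<^sub>m m)" "n * m" "r * m" "kron Y B" "k * m"])
      (use XY assms(3) in \<open>auto simp: kron_mult[of _ n r _ m m _ k _ m]\<close>)
qed

section \<open>Trigonometric sums and the orthonormal sine transform\<close>

lemma sum_cos_telescope:
  "2 * sin y * (\<Sum>k\<le>n. cos (2 * real k * y)) = sin ((2 * real n + 1) * y) + sin y"
proof (induction n)
  case (Suc n)
  let ?z = "2 * real (Suc n) * y"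
  \<comment> \<open>The summand 2 sin y cos z is sin (z + y) - sin (z - y), which telescopes since
    consecutive z differ by 2 y.\<close>
  have "sin ((2 * real (Suc n) + 1) * y) - sin ((2 * real n + 1) * y) = sin (?z + y) - sin (?z - y)"
    by (simp add: algebra_simps)
  also have "\<dots> = 2 * sin y * cos ?z" by (simp add: sin_add sin_diff)
  finally show ?case using Suc by (simp add: distrib_left)
qed simp

text \<open>With y = q pi / (2 (n + 1)) one has (2 n + 1) y = q pi - y, so the telescoped sum is a
  multiple of sin y depending on the parity of q alone. The range of q means 0 < y < pi, which
  permits division by sin y.\<close>

lemma sum_cos_grid:
  assumes "0 < q" "q < 2 * (n + 1)"
  shows "(\<Sum>k\<le>n. cos (real q * real k * (pi / real (n + 1)))) = (1 - (-1) ^ q) / 2"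
proof -
  define y where "y = real q * (pi / real (n + 1)) / 2"
  have y: "2 * real (n + 1) * y = real q * pi"
  proof -
    have "2 * N * (p * (pi / N) / 2) = p * pi" if "N \<noteq> 0" for N p :: real using that by simp
    from this[of "real (n + 1)" "real q"] show ?thesis unfolding y_def by fastforce
  qed
  have "real q < 2 * real (n + 1)" using assms(2) by linarith
  then have "2 * real (n + 1) * y < 2 * real (n + 1) * pi"
    unfolding y by (intro mult_strict_right_mono) auto
  then have "y < pi" by (simp add: mult_less_cancel_left)
  moreover have "0 < y" using assms(1) by (simp add: y_def)
  ultimately have s: "sin y > 0" by (intro sin_gt_zero)
  have "(2 * real n + 1) * y = real q * pi - y"
    using y by (simp add: algebra_simps)
  then have "sin ((2 * real n + 1) * y) = - ((-1) ^ q) * sin y"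
    by (simp add: sin_diff)
  with sum_cos_telescope[of y n]
  have "2 * sin y * (\<Sum>k\<le>n. cos (2 * real k * y)) = (1 - (-1) ^ q) * sin y"
    by (simp add: algebra_simps)
  then have "sin y * (2 * (\<Sum>k\<le>n. cos (2 * real k * y))) = sin y * (1 - (-1) ^ q)"
    by (simp add: mult_ac)
  then have "2 * (\<Sum>k\<le>n. cos (2 * real k * y)) = 1 - (-1) ^ q"
    using s by (subst (asm) mult_cancel_left) simp
  then have "(\<Sum>k\<le>n. cos (2 * real k * y)) = (1 - (-1) ^ q) / 2" by simp
  moreover have "2 * real k * y = real q * real k * (pi / real (n + 1))" for k
  proof -
    have "2 * k * (q * w / 2) = q * k * w" for k q w :: real by simp
    then show ?thesis unfolding y_def .
  qed
  ultimately show ?thesis by simp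
qed

text \<open>The discrete sine transform DST-I in orthonormal scaling. The increments of i and j come
  from indices starting at 0; frequencies and grid points run from 1 to n.\<close>

definition sine_mat :: "nat \<Rightarrow> real mat" where
  "sine_mat n = mat n n (\<lambda>(i, j). sqrt (2 / real (n + 1)) * sin (real (i + 1) * real (j + 1) * (pi / real (n + 1))))"

text \<open>A product of two sines is half a difference of cosines with frequencies |i - j| and i +
  j + 2. These have equal parity, so for i and j distinct their grid sums cancel; for i = j the
  first sum is n + 1 and the second vanishes.\<close>

lemma orthonormal_sine_mat: "orthonormal_mat n (sine_mat n)"
proof (rule orthonormal_matI)
  let ?h = "pi / real (n + 1)"
  show "sine_mat n * transpose_mat (sine_mat n) = 1\<^sub>m n"
  proof (rule eq_matI)
    fix i j assume "i < dim_row (1\<^sub>m n :: real mat)" "j < dim_col (1\<^sub>m n :: real mat)"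
    then have ij: "i < n" "j < n" by auto
    define F where "F k = sin (real (i + 1) * real k * ?h) * sin (real (j + 1) * real k * ?h)" for k
    have "(sine_mat n * transpose_mat (sine_mat n)) $$ (i, j) = (\<Sum>k<n. 2 / real (n + 1) * F (Suc k))"
    proof -
      define c where "c = sqrt (2 / real (n + 1))"
      have "c * c = 2 / real (n + 1)" by (simp add: c_def)
      then have cc: "c * x * (c * y) = 2 / real (n + 1) * (x * y)" for x y
        by (metis mult.assoc mult.left_commute)
      have "(sine_mat n * transpose_mat (sine_mat n)) $$ (i, j)
        = (\<Sum>k<n. sine_mat n $$ (i, k) * sine_mat n $$ (j, k))"
        using ij by (simp add: sine_mat_def scalar_prod_def lessThan_atLeast0)
      also have "\<dots> = (\<Sum>k<n. 2 / real (n + 1) * F (Suc k))"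
      proof (intro sum.cong refl)
        fix k assume "k \<in> {..<n}"
        then have "sine_mat n $$ (i, k) * sine_mat n $$ (j, k)
          = c * sin (real (i + 1) * real (k + 1) * ?h) * (c * sin (real (j + 1) * real (k + 1) * ?h))"
          using ij by (simp add: sine_mat_def c_def)
        then show "sine_mat n $$ (i, k) * sine_mat n $$ (j, k) = 2 / real (n + 1) * F (Suc k)"
          unfolding cc F_def by simp
      qed
      finally show ?thesis .
    qed
    \<comment> \<open>F 0 = 0, so the term k = 0 can be added; this completes the sum to the grid of
      \<open>sum_cos_grid\<close>.\<close>
    also have "\<dots> = 2 / real (n + 1) * (\<Sum>k\<le>n. F k)"
      unfolding sum_distrib_left[symmetric] sum.atMost_shift by (simp add: F_def)
    also have "(\<Sum>k\<le>n. F k) = (if i = j then real (n + 1) / 2 else 0)"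
    proof -
      obtain q where q: "real i - real j = real q \<or> real i - real j = - real q"
        "q < n" "q = 0 \<longleftrightarrow> i = j" "even q \<longleftrightarrow> even (i + j + 2)"
      proof (cases "i \<ge> j")
        case True
        then show ?thesis using that[of "i - j"] ij by auto
      next
        case False
        then have "even (j - i) \<longleftrightarrow> even (i + j + 2)" by presburger
        from that[of "j - i", OF _ _ _ this] show ?thesis using False ij by auto
      qed
      have F: "2 * F k = cos (real q * real k * ?h) - cos (real (i + j + 2) * real k * ?h)" for k
      proof -
        define x where "x = real k * ?h"
        define u v where "u = real (i + 1) * x" and "v = real (j + 1) * x"
        have "(real i - real j) * x = u - v" "real (i + j + 2) * x = u + v"
          by (simp_all add: u_def v_def algebra_simps)
        then have "2 * F k = cos ((real i - real j) * x) - cos (real (i + j + 2) * x)"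
          unfolding F_def mult.assoc x_def[symmetric] u_def[symmetric] v_def[symmetric]
          by (simp only: cos_diff cos_add)
        moreover have "cos ((real i - real j) * x) = cos (real q * x)" using q(1) by auto
        ultimately show ?thesis by (simp add: x_def mult.assoc)
      qed
      have "2 * (\<Sum>k\<le>n. F k) = (\<Sum>k\<le>n. cos (real q * real k * ?h)) - (\<Sum>k\<le>n. cos (real (i + j + 2) * real k * ?h))"
        by (simp add: sum_distrib_left F sum_subtractf)
      also have "(\<Sum>k\<le>n. cos (real (i + j + 2) * real k * ?h)) = (1 - (-1) ^ (i + j + 2)) / 2"
        using ij by (intro sum_cos_grid) auto
      finally have *: "2 * (\<Sum>k\<le>n. F k) = (\<Sum>k\<le>n. cos (real q * real k * ?h)) - (1 - (-1) ^ (i + j + 2)) / 2" .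
      show ?thesis
      proof (cases "i = j")
        case True
        then show ?thesis using * q(3) by simp
      next
        case False
        then have "(\<Sum>k\<le>n. cos (real q * real k * ?h)) = (1 - (-1) ^ q) / 2"
          using q by (intro sum_cos_grid) auto
        moreover have "(-1 :: real) ^ q = (-1) ^ (i + j + 2)"
          using q(4) by (simp add: minus_one_power_iff)
        ultimately have "2 * (\<Sum>k\<le>n. F k) = 0" unfolding * by (simp only: diff_self)
        then show ?thesis using False by simp
      qed
    qed
    finally show "(sine_mat n * transpose_mat (sine_mat n)) $$ (i, j) = (1\<^sub>m n :: real mat) $$ (i, j)"
      using ij by simp
  qed (auto simp: sine_mat_def)
qed (simp add: sine_mat_def)

text \<open>The eigenvector equation is the addition formula sin ((i + 2) x) + sin (i x) = 2 cos x
  sin ((i + 1) x). The truncated first and last rows obey it too, because the sine vector vanishes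
  at the virtual grid points 0 and n + 1.\<close>

lemma G2_sine: "G2 n = conj_diag n (sine_mat n) (\<lambda>k. - 2 * cos (real (k + 1) * (pi / real (n + 1))))"
proof -
  let ?h = "pi / real (n + 1)"
  let ?d = "\<lambda>k. - 2 * cos (real (k + 1) * ?h)"
  define S where "S = sine_mat n"
  note S = orthonormal_matD[OF orthonormal_sine_mat[of n], folded S_def]
  have G: "G2 n \<in> carrier_mat n n" by (simp add: G2_def toeplitz_def)
  have "G2 n * S = S * mat_diag n ?d"
  proof (rule eq_matI)
    fix i k assume "i < dim_row (S * mat_diag n ?d)" "k < dim_col (S * mat_diag n ?d)"
    then have ik: "i < n" "k < n" using S by auto
    define s where "s l = sqrt (2 / real (n + 1)) * sin (real l * real (k + 1) * ?h)" for l
    have Ss: "S $$ (l, k) = s (l + 1)" if "l < n" for l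
      using that ik by (simp add: S_def sine_mat_def s_def)
    have s0: "s 0 = 0" by (simp add: s_def)
    have "real (n + 1) * real (k + 1) * ?h = real (k + 1) * pi" by (simp add: field_simps)
    then have sn: "s (n + 1) = 0" unfolding s_def by (simp only: sin_npi mult_zero_right)
    have "(G2 n * S) $$ (i, k) = (\<Sum>l<n. G2 n $$ (i, l) * S $$ (l, k))"
      using ik G S(1) by (simp add: scalar_prod_def lessThan_atLeast0)
    also have "\<dots> = (\<Sum>l<n. (if l = i + 1 then - s (i + 2) else 0) + (if l + 1 = i then - s i else 0))"
      using ik by (intro sum.cong) (auto simp: G2_def toeplitz_def Ss)
    also have "\<dots> = (if i + 1 < n then - s (i + 2) else 0) + (\<Sum>l<n. if l + 1 = i then - s i else 0)"
      by (simp add: sum.distrib)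
    also have "(\<Sum>l<n. if l + 1 = i then - s i else 0) = - s i"
      using ik s0 by (cases i) auto
    also have "(if i + 1 < n then - s (i + 2) else 0) = - s (i + 2)"
    proof (cases "i + 1 < n")
      case False
      then have "i + 2 = n + 1" using ik by auto
      then show ?thesis using sn False by simp
    qed simp
    also have "- s (i + 2) + - s i = s (i + 1) * ?d k"
    proof -
      define x where "x = real (k + 1) * ?h"
      have "sin (real (i + 2) * x) + sin (real i * x) = sin (real (i + 1) * x + x) + sin (real (i + 1) * x - x)"
        by (simp add: algebra_simps)
      also have "\<dots> = 2 * sin (real (i + 1) * x) * cos x"
        by (simp only: sin_add sin_diff)
      finally have rec: "sin (real (i + 2) * x) = 2 * sin (real (i + 1) * x) * cos x - sin (real i * x)" by simp
      show ?thesis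
        unfolding s_def mult.assoc x_def[symmetric] rec by (simp add: right_diff_distrib mult_ac)
    qed
    also have "\<dots> = (S * mat_diag n ?d) $$ (i, k)"
      using ik S(1) by (simp add: mat_diag_mult_right[of _ n] Ss)
    finally show "(G2 n * S) $$ (i, k) = (S * mat_diag n ?d) $$ (i, k)" .
  qed (use G S in auto)
  then have "conj_diag n S ?d = (G2 n * S) * transpose_mat S" by (simp add: conj_diag_def)
  also have "\<dots> = G2 n" using G S by (simp add: assoc_mult_mat[of _ n n _ n _ n])
  finally show ?thesis by (simp add: S_def)
qed

lemma G1_eq: "G1 n = 2 \<cdot>\<^sub>m 1\<^sub>m n + G2 n"
  by (rule eq_matI) (auto simp: G1_def G2_def toeplitz_def)

section \<open>The splitting for a general shift\<close>

lemma norm_bounded_lower_block: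
  assumes "norm_bounded n c X"
  shows "norm_bounded (n + n) c (four_block_mat (0\<^sub>m n n) (0\<^sub>m n n) (0\<^sub>m n n) X)"
  unfolding norm_bounded_def
proof (intro conjI ballI)
  have X: "X \<in> carrier_mat n n" using assms by (simp add: norm_bounded_def)
  then show "four_block_mat (0\<^sub>m n n) (0\<^sub>m n n) (0\<^sub>m n n) X \<in> carrier_mat (n + n) (n + n)" by simp
  fix v :: "real vec" assume v: "v \<in> carrier_vec (n + n)"
  define x y where "x = vec_first v n" and "y = vec_last v n"
  have xy: "x \<in> carrier_vec n" "y \<in> carrier_vec n" and vxy: "v = x @\<^sub>v y"
    using v by (auto simp: x_def y_def)
  have "four_block_mat (0\<^sub>m n n) (0\<^sub>m n n) (0\<^sub>m n n) X *\<^sub>v v = 0\<^sub>v n @\<^sub>v (X *\<^sub>v y)"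
    unfolding vxy using X xy
    by (subst four_block_mat_mult_vec[of _ n n _ n _ n]) auto
  then have "(four_block_mat (0\<^sub>m n n) (0\<^sub>m n n) (0\<^sub>m n n) X *\<^sub>v v) \<bullet> (four_block_mat (0\<^sub>m n n) (0\<^sub>m n n) (0\<^sub>m n n) X *\<^sub>v v)
    = (X *\<^sub>v y) \<bullet> (X *\<^sub>v y)"
    using X xy by (simp add: scalar_prod_append[of _ n _ n])
  also have "\<dots> \<le> c\<^sup>2 * (y \<bullet> y)" using assms xy by (simp add: norm_bounded_def)
  also have "\<dots> \<le> c\<^sup>2 * (v \<bullet> v)"
    unfolding vxy using xy real_scalar_prod_self_nonneg[of x]
    by (intro mult_left_mono) (simp_all add: scalar_prod_append[of _ n _ n])
  finally show "(four_block_mat (0\<^sub>m n n) (0\<^sub>m n n) (0\<^sub>m n n) X *\<^sub>v v) \<bullet> (four_block_mat (0\<^sub>m n n) (0\<^sub>m n n) (0\<^sub>m n n) X *\<^sub>v v)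
     \<le> c\<^sup>2 * (v \<bullet> v)" .
qed

lemma diff_four_block_mat:
  assumes "A \<in> carrier_mat n n" "B \<in> carrier_mat n n" "C \<in> carrier_mat n n" "D \<in> carrier_mat n n"
    "A' \<in> carrier_mat n n" "B' \<in> carrier_mat n n" "C' \<in> carrier_mat n n" "D' \<in> carrier_mat n n"
  shows "four_block_mat A B C D - four_block_mat A' B' C' D'
    = four_block_mat (A - A') (B - B') (C - C') (D - D' :: real mat)"
  using assms by (intro eq_matI) auto

text \<open>With \<open>U = diag(I, Z)\<close>, \<open>C = diag(H, H)\<close> and \<open>Q\<^sub>0\<close> the orthogonal factor of
  \<open>((a, -G), (-G, -a)) = C Q\<^sub>0\<close>, the matrix differs from \<open>U C Q\<^sub>0 U\<^sup>T\<close> by low rank, and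
  \<open>C\<^sup>-\<^sup>1 U C - U = diag(0, H\<^sup>-\<^sup>1 (Z H - H Z))\<close>.  Writing \<open>H = G + D\<close> with \<open>D\<close> small, the commutator
  with \<open>G\<close> has low rank, while \<open>H\<^sup>-\<^sup>1 (Z D - D Z)\<close> is small away from the few small eigenvalues of \<open>H\<close>.\<close>

lemma preconditioned_splitting:
  fixes g :: "nat \<Rightarrow> real" and a :: real
  defines "h \<equiv> \<lambda>i. sqrt ((g i)\<^sup>2 + a\<^sup>2)"
  assumes oW: "orthonormal_mat n W" and oZ: "orthonormal_mat n Z" and a: "a > 0"
    and G: "G = conj_diag n W g"
    and \<beta>: "\<And>i. i < n \<Longrightarrow> \<bar>h i - g i\<bar> \<le> \<beta>" "0 \<le> \<beta>" and M: "M > 0"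
    and S: "finite S" "\<And>i. i < n \<Longrightarrow> h i < M \<Longrightarrow> i \<in> S"
    and T: "T \<in> carrier_mat n n" "rank_le r1 (T + Z * G)"
    and comm: "rank_le r2 (Z * G - G * Z)"
    and C1: "C1 \<in> carrier_mat n n" "rank_le r3 (C1 - a \<cdot>\<^sub>m 1\<^sub>m n)"
    and C2: "C2 \<in> carrier_mat n n" "rank_le r4 (C2 - a \<cdot>\<^sub>m 1\<^sub>m n)"
    and P: "P = four_block_mat (sqrt_mat (transpose_mat G * G + a\<^sup>2 \<cdot>\<^sub>m 1\<^sub>m n)) (0\<^sub>m n n) (0\<^sub>m n n)
                  (sqrt_mat (G * transpose_mat G + a\<^sup>2 \<cdot>\<^sub>m 1\<^sub>m n))"
    and A: "A = four_block_mat C1 (transpose_mat T) T (- C2)"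
  shows "\<exists>Q E R. Q \<in> carrier_mat (n + n) (n + n) \<and> R \<in> carrier_mat (n + n) (n + n)
    \<and> inv_mat P * A = Q + E + R \<and> symmetric_mat Q \<and> orthonormal_mat (n + n) Q
    \<and> norm_bounded (n + n) (2 * \<beta> / M) E
    \<and> rank_le (card S + r2 + (r3 + r1 + r1 + r4)) R"
proof -
  note W = orthonormal_matD[OF oW] and Z = orthonormal_matD[OF oZ]
  note assoc = assoc_mult_mat[of _ n n _ n _ n] and assoc2 = assoc_mult_mat[of _ "n + n" "n + n" _ "n + n" _ "n + n"]
  define c where "c = conj_diag n W"
  have c[simp]: "c d \<in> carrier_mat n n" for d using W(1) by (simp add: c_def)
  have cdim[simp]: "dim_row (c d) = n" "dim_col (c d) = n" for d by (rule carrier_matD[OF c])+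
  have c_mult: "c d * c e = c (\<lambda>i. d i * e i)" for d e by (simp add: c_def conj_diag_mult[OF oW])
  have c_add: "c d + c e = c (\<lambda>i. d i + e i)" for d e by (simp add: c_def conj_diag_add[OF W(1)])
  have c_minus: "c d - c e = c (\<lambda>i. d i - e i)" for d e by (simp add: c_def conj_diag_minus[OF W(1)])
  have c_const: "c (\<lambda>_. x) = x \<cdot>\<^sub>m 1\<^sub>m n" for x by (simp add: c_def conj_diag_const[OF oW])
  have c_one: "c (\<lambda>_. 1) = 1\<^sub>m n" unfolding c_const by (intro eq_matI) auto
  have c_transpose: "transpose_mat (c d) = c d" for d by (simp add: c_def transpose_conj_diag[OF W(1)])
  have h: "h i > 0" "(h i)\<^sup>2 = (g i)\<^sup>2 + a\<^sup>2" for i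
    using a by (auto simp: h_def intro!: add_nonneg_pos)
  have h0: "h i \<noteq> 0" for i using h(1)[of i] by simp
  have hh: "h i * h i = g i * g i + a * a" for i using h(2)[of i] by (simp add: power2_eq_square)
  have Gc: "G = c g" by (simp add: G c_def)
  define H Hi where "H = c h" and "Hi = c (\<lambda>i. 1 / h i)"
  have HHi: "H * Hi = 1\<^sub>m n" "Hi * H = 1\<^sub>m n"
    using h0 by (simp_all add: H_def Hi_def c_mult c_one)
  have carr[simp]: "H \<in> carrier_mat n n" "Hi \<in> carrier_mat n n" by (simp_all add: H_def Hi_def)

  \<comment> \<open>G is symmetric, so both diagonal blocks of P are the root of G^2 + a^2, which is
    H.\<close>
  have "c g * c g + a\<^sup>2 \<cdot>\<^sub>m 1\<^sub>m n = c (\<lambda>i. (h i)\<^sup>2)"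
    by (simp add: c_mult c_const[symmetric] c_add hh power2_eq_square)
  moreover have "sqrt_mat (c (\<lambda>i. (h i)\<^sup>2)) = H"
    unfolding c_def H_def using h(1) by (intro sqrt_mat_conj_diag[OF oW]) auto
  ultimately have P': "P = four_block_mat H (0\<^sub>m n n) (0\<^sub>m n n) H"
    unfolding P Gc c_transpose by simp
  define Pi where "Pi = four_block_mat Hi (0\<^sub>m n n) (0\<^sub>m n n) Hi"
  have Pc: "P \<in> carrier_mat (n + n) (n + n)" "Pi \<in> carrier_mat (n + n) (n + n)"
    by (simp_all add: P' Pi_def)
  have PPi: "P * Pi = 1\<^sub>m (n + n)" "Pi * P = 1\<^sub>m (n + n)"
    unfolding P' Pi_def by (simp_all add: diag_block_mult HHi)
  have invP: "inv_mat P = Pi" by (rule inv_mat_eqI[OF Pc PPi])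

  \<comment> \<open>On each eigenvector of G the blocks act as the 2 by 2 matrix ((a, -g), (-g, -a))
    / h, a symmetric involution because a^2 + g^2 = h^2.\<close>
  define Q0 where "Q0 = four_block_mat (c (\<lambda>i. a / h i)) (c (\<lambda>i. - g i / h i))
    (c (\<lambda>i. - g i / h i)) (c (\<lambda>i. - a / h i))"
  have Q0: "Q0 \<in> carrier_mat (n + n) (n + n)" by (simp add: Q0_def)
  have tQ0: "transpose_mat Q0 = Q0"
    unfolding Q0_def by (subst transpose_four_block_mat[of _ n n _ n _ n]) (simp_all add: c_transpose)
  have one: "a / h i * (a / h i) + g i / h i * (g i / h i) = 1" for i
  proof -
    have "a * a + g i * g i = h i * h i" by (simp add: hh)
    then show ?thesis
      unfolding times_divide_times_eq add_divide_distrib[symmetric] using h0[of i] by (simp only:) simp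
  qed
  have Q0Q0: "Q0 * Q0 = 1\<^sub>m (n + n)"
  proof -
    have "Q0 * Q0 = four_block_mat (c (\<lambda>_. 1)) (c (\<lambda>_. 0)) (c (\<lambda>_. 0)) (c (\<lambda>_. 1))"
      unfolding Q0_def by (subst mult_four_block_mat[OF c c c c c c c c])
        (simp add: c_mult c_add one add.commute[of "g _ * g _ / _"] one[unfolded times_divide_times_eq] algebra_simps)
    also have "\<dots> = 1\<^sub>m (n + n)" unfolding c_const by (intro eq_matI) auto
    finally show ?thesis .
  qed
  have oQ0: "orthonormal_mat (n + n) Q0" using Q0Q0 tQ0 by (intro orthonormal_matI[OF Q0]) simp

  define U where "U = four_block_mat (1\<^sub>m n) (0\<^sub>m n n) (0\<^sub>m n n) Z"
  define Ut where "Ut = four_block_mat (1\<^sub>m n) (0\<^sub>m n n) (0\<^sub>m n n) (transpose_mat Z)"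
  have U: "U \<in> carrier_mat (n + n) (n + n)" "Ut \<in> carrier_mat (n + n) (n + n)"
    using Z by (simp_all add: U_def Ut_def)
  have tU: "transpose_mat U = Ut"
    unfolding U_def Ut_def using Z by (subst transpose_four_block_mat[of _ n n _ n _ n]) simp_all
  have "U * transpose_mat U = 1\<^sub>m (n + n)"
    unfolding tU unfolding U_def Ut_def using Z by (simp add: diag_block_mult)
  then have oU: "orthonormal_mat (n + n) U" by (rule orthonormal_matI[OF U(1)])
  have oUt: "orthonormal_mat (n + n) Ut" using orthonormal_mat_transpose[OF oU] by (simp add: tU)
  define V where "V = Q0 * Ut"
  have oV: "orthonormal_mat (n + n) V" unfolding V_def by (rule orthonormal_mat_mult[OF oQ0 oUt])
  note V = orthonormal_matD(1)[OF oV]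
  define Q where "Q = U * V"
  have oQ: "orthonormal_mat (n + n) Q" unfolding Q_def by (rule orthonormal_mat_mult[OF oU oV])
  note Q = orthonormal_matD(1)[OF oQ]
  have symQ: "symmetric_mat Q"
  proof -
    have "transpose_mat Ut = U" using tU by (metis transpose_transpose)
    then have "transpose_mat Q = U * Q0 * Ut"
      unfolding Q_def V_def using U Q0
      by (simp add: transpose_mult[of _ "n + n" "n + n" _ "n + n"] tU tQ0)
    then show ?thesis unfolding symmetric_mat_def Q_def V_def using U Q0 by (simp add: assoc2)
  qed

  define X where "X = Z * c (\<lambda>i. - g i)"
  have X: "X \<in> carrier_mat n n" using Z by (simp add: X_def)
  \<comment> \<open>The model matrix, in which T is replaced by -Z G and both diagonal blocks are
    exact multiples of the identity. It equals U P V without error; in the last block the scalar a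
    commutes with Z, and Z Z^T = I.\<close>
  define A' where "A' = four_block_mat (c (\<lambda>_. a)) (transpose_mat X) X (- (c (\<lambda>_. a)))"
  have A'c: "A' \<in> carrier_mat (n + n) (n + n)" by (simp add: A'_def uminus_carrier_mat)
  have A': "A' = U * P * V"
  proof -
    have "P * Q0 = four_block_mat (c (\<lambda>_. a)) (c (\<lambda>i. - g i)) (c (\<lambda>i. - g i)) (c (\<lambda>_. - a))"
      unfolding P' Q0_def H_def
      by (subst mult_four_block_mat[OF c zero_carrier_mat zero_carrier_mat c c c c c])
        (simp add: c_mult h0 right_add_zero_mat[of _ n n] left_add_zero_mat[of _ n n] left_mult_zero_mat[of _ n n])
    moreover have "U * \<dots> = four_block_mat (c (\<lambda>_. a)) (c (\<lambda>i. - g i)) X (Z * c (\<lambda>_. - a))"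
      unfolding U_def X_def using Z(1)
      by (subst mult_four_block_mat[OF one_carrier_mat zero_carrier_mat zero_carrier_mat Z(1) c c c c])
        (simp add: right_add_zero_mat[of _ n n] left_add_zero_mat[of _ n n] left_mult_zero_mat[of _ n n] left_mult_one_mat[of _ n n])
    moreover have "\<dots> * Ut = four_block_mat (c (\<lambda>_. a)) (c (\<lambda>i. - g i) * transpose_mat Z) X (Z * c (\<lambda>_. - a) * transpose_mat Z)"
      unfolding Ut_def using Z(1) X
      by (subst mult_four_block_mat[OF c c X mult_square_mat_carrier[OF Z(1) c] one_carrier_mat zero_carrier_mat zero_carrier_mat Z(2)])
        (simp add: right_add_zero_mat[of _ n n] left_add_zero_mat[of _ n n] right_mult_zero_mat[of _ n n] right_mult_one_mat[of _ n n])
    moreover have "c (\<lambda>i. - g i) * transpose_mat Z = transpose_mat X"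
      unfolding X_def using Z(1) by (simp add: transpose_mult[of _ n n _ n] c_transpose)
    moreover have "Z * c (\<lambda>_. - a) * transpose_mat Z = - (c (\<lambda>_. a))"
    proof -
      have "Z * c (\<lambda>_. - a) * transpose_mat Z = (- a) \<cdot>\<^sub>m 1\<^sub>m n"
        unfolding c_const using Z
        by (simp add: mult_smult_distrib[of _ n n _ n] mult_smult_assoc_mat[of _ n n _ n] right_mult_one_mat[of _ n n])
      then show ?thesis by (simp add: c_const) (intro eq_matI; simp)
    qed
    ultimately have "U * (P * Q0) * Ut = A'" unfolding A'_def by simp
    then show ?thesis unfolding V_def using U Pc Q0 by (simp add: assoc2)
  qed

  \<comment> \<open>This is H^-1 (Z H - H Z), the only nonzero block of P^-1 U P - U.\<close>
  define Y where "Y = Hi * Z * H - Z"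
  define D where "D = c (\<lambda>i. h i - g i)"
  define K where "K = Z * D - D * Z"
  \<comment> \<open>H^-1 is split at the threshold M: \<open>HH\<close> has norm at most 1 / M, and
    \<open>HL\<close> is supported on the eigenvalues indexed by S.\<close>
  define HL HH where "HL = c (\<lambda>i. if h i < M then 1 / h i else 0)" and "HH = c (\<lambda>i. if h i < M then 0 else 1 / h i)"
  have carr2[simp]: "D \<in> carrier_mat n n" "K \<in> carrier_mat n n" "HL \<in> carrier_mat n n" "HH \<in> carrier_mat n n" "G \<in> carrier_mat n n" "Y \<in> carrier_mat n n"
    "Z * G - G * Z \<in> carrier_mat n n"
    using Z(1) by (simp_all add: D_def K_def HL_def HH_def Gc Y_def minus_carrier_mat)
  have Hi_split: "Hi = HH + HL"
    unfolding HH_def HL_def Hi_def c_add by (rule arg_cong[of _ _ c]) auto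
  have H_split: "H = D + G" by (simp add: H_def D_def Gc c_add)
  have Y_eq: "Y = HH * K + (HL * K + Hi * (Z * G - G * Z))"
  proof -
    have "Y = Hi * (Z * H) - Hi * (H * Z)"
      unfolding Y_def using Z(1) HHi(2) by (simp add: assoc[symmetric] left_mult_one_mat[of Z n n] del: assoc_mult_mat)
    also have "\<dots> = Hi * (Z * H - H * Z)"
      using Z(1) by (simp add: mult_minus_distrib_mat[of _ n n _ n])
    also have "Z * H - H * Z = K + (Z * G - G * Z)"
    proof -
      have "p + q - (r + s) = (p - r) + (q - s)" if "p \<in> carrier_mat n n" "q \<in> carrier_mat n n"
        "r \<in> carrier_mat n n" "s \<in> carrier_mat n n" for p q r s :: "real mat"
        using that by (intro eq_matI) auto
      then show ?thesis
        unfolding H_split K_def using Z(1)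
        by (simp add: mult_add_distrib_mat[of _ n n _ n] add_mult_distrib_mat[of _ n n _ _ n])
    qed
    also have "Hi * \<dots> = Hi * K + Hi * (Z * G - G * Z)"
      by (rule mult_add_distrib_mat[of _ n n _ n]) simp_all
    also have "Hi * K = HH * K + HL * K"
      unfolding Hi_split by (rule add_mult_distrib_mat[of _ n n _ _ n]) simp_all
    finally show ?thesis by (simp add: assoc_add_mat[of _ n n])
  qed
  \<comment> \<open>\<open>Y1\<close> becomes the small part. In \<open>Y2\<close> one summand has
    low rank by the cutoff, the other by the commutator of Z with G.\<close>
  define Y1 Y2 where "Y1 = HH * K" and "Y2 = HL * K + Hi * (Z * G - G * Z)"
  have Yc[simp]: "Y1 \<in> carrier_mat n n" "Y2 \<in> carrier_mat n n" by (simp_all add: Y1_def Y2_def)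
  let ?z = "0\<^sub>m n n :: real mat"
  define F1 F2 where "F1 = four_block_mat ?z ?z ?z Y1" and "F2 = four_block_mat ?z ?z ?z Y2"
  have F: "F1 \<in> carrier_mat (n + n) (n + n)" "F2 \<in> carrier_mat (n + n) (n + n)"
    by (simp_all add: F1_def F2_def)
  have PiUP: "Pi * U * P = U + F1 + F2"
  proof -
    have "Pi * U * P = four_block_mat (Hi * 1\<^sub>m n * H) ?z ?z (Hi * Z * H)"
      unfolding Pi_def U_def P' using Z(1) by (simp add: diag_block_mult)
    also have "Hi * 1\<^sub>m n * H = 1\<^sub>m n" by (simp add: HHi right_mult_one_mat[of Hi n n])
    also have "Hi * Z * H = Z + (Y1 + Y2)"
    proof -
      have "B = Z + (B - Z)" if "B \<in> carrier_mat n n" for B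
        using that Z(1) by (intro eq_matI) auto
      then show ?thesis
        unfolding Y1_def Y2_def Y_eq[symmetric] Y_def using Z(1) by simp
    qed
    finally have "Pi * U * P = four_block_mat (1\<^sub>m n) ?z ?z (Z + (Y1 + Y2))" .
    moreover have "four_block_mat (1\<^sub>m n) ?z ?z (Z + (B + B'))
      = four_block_mat (1\<^sub>m n) ?z ?z Z + four_block_mat ?z ?z ?z B + four_block_mat ?z ?z ?z B'"
      if "B \<in> carrier_mat n n" "B' \<in> carrier_mat n n" for B B'
      using that Z(1) by (intro eq_matI) auto
    ultimately show ?thesis unfolding U_def F1_def F2_def by simp
  qed
  \<comment> \<open>Multiplication by the orthogonal V changes neither bound: E inherits the norm
    bound of F1 and R1 the rank bound of F2.\<close>
  define E R1 where "E = F1 * V" and "R1 = F2 * V"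
  define R2 where "R2 = Pi * (A - A')"
  have ER: "E \<in> carrier_mat (n + n) (n + n)" "R1 \<in> carrier_mat (n + n) (n + n)"
    using F V by (simp_all add: E_def R1_def)
  have Ac: "A \<in> carrier_mat (n + n) (n + n)" unfolding A using C1 C2 T by (simp add: uminus_carrier_mat)
  have AA': "A - A' \<in> carrier_mat (n + n) (n + n)" using A'c by (simp add: minus_carrier_mat)
  have R2c: "R2 \<in> carrier_mat (n + n) (n + n)" using AA' Pc by (simp add: R2_def)

  have "Pi * A' = Pi * U * P * V" unfolding A' using U Pc V by (simp add: assoc2)
  also have "\<dots> = Q + E + R1"
    unfolding PiUP Q_def E_def R1_def using U F V
    by (simp add: add_mult_distrib_mat[of _ "n + n" "n + n" _ _ "n + n"] assoc_add_mat[of _ "n + n" "n + n"])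
  finally have PiA': "Pi * A' = Q + E + R1" .
  have "A = A' + (A - A')" using Ac A'c by (intro eq_matI) auto
  then have "Pi * A = Pi * A' + R2"
    unfolding R2_def using mult_add_distrib_mat[OF Pc(2) A'c AA'] by simp
  then have eq: "inv_mat P * A = Q + E + (R1 + R2)"
    unfolding invP PiA' using Q ER R2c by (simp add: assoc_add_mat[of _ "n + n" "n + n"])

  \<comment> \<open>Z is orthogonal and D has norm at most \<beta>, so Z D - D Z is bounded by 2
    \<beta>, and \<open>HH\<close> contributes the factor 1 / M.\<close>
  have "norm_bounded n (1 * \<beta>) (Z * D)" "norm_bounded n (\<beta> * 1) (D * Z)"
    using norm_bounded_conj_diag[OF oW \<beta>(1)] norm_bounded_orthonormal[OF oZ]
    unfolding D_def c_def by (intro norm_bounded_mult; simp)+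
  then have "norm_bounded n (2 * \<beta>) K"
    unfolding K_def using norm_bounded_diff[of n \<beta>] by simp
  moreover have "norm_bounded n (1 / M) HH"
    unfolding HH_def c_def using M h(1)
    by (intro norm_bounded_conj_diag[OF oW]) (auto simp: abs_of_pos frac_le)
  ultimately have "norm_bounded n (1 / M * (2 * \<beta>)) Y1"
    unfolding Y1_def by (intro norm_bounded_mult)
  from norm_bounded_mult[OF norm_bounded_lower_block[OF this] norm_bounded_orthonormal[OF oV]]
  have E: "norm_bounded (n + n) (2 * \<beta> / M) E" by (simp add: E_def F1_def)

  have "rank_le (card S) HL"
    unfolding HL_def c_def using S by (intro rank_le_conj_diag[OF W(1)]) auto
  then have "rank_le (card S) (HL * K)"
    by (rule rank_le_mult_right[of _ _ n n _ n]) simp_all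
  moreover have "rank_le r2 (Hi * (Z * G - G * Z))"
    by (rule rank_le_mult_left[OF comm, of n n _ n]) simp_all
  ultimately have "rank_le (card S + r2) Y2"
    unfolding Y2_def by (rule rank_le_add[of _ _ _ _ n n]) simp_all
  then have "rank_le (0 + 0 + 0 + (card S + r2)) F2"
    unfolding F2_def by (intro rank_le_four_block[of _ _ _ _ _ _ _ _ n] rank_le_0) simp_all
  then have R1: "rank_le (card S + r2) R1"
    unfolding R1_def using F V by (intro rank_le_mult_right[of _ _ "n + n" "n + n" _ "n + n"]) simp_all

  have TX: "T - X = T + Z * G"
  proof -
    have "X = - (Z * G)"
    proof -
      have "- G = (- 1) \<cdot>\<^sub>m G" by (intro eq_matI) auto
      then have "c (\<lambda>i. - g i) = - G"
        by (simp add: Gc c_def conj_diag_smult[OF W(1)])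
      then show ?thesis unfolding X_def using Z(1) by (simp add: Gc)
    qed
    then show ?thesis using T(1) Z(1) by (intro eq_matI) auto
  qed
  have "A - A' = four_block_mat (C1 - c (\<lambda>_. a)) (transpose_mat (T - X)) (T - X) (- C2 - - c (\<lambda>_. a))"
    unfolding A A'_def using C1 C2 T X
    by (subst diff_four_block_mat[of _ n]) (simp_all add: uminus_carrier_mat transpose_minus[of _ n n])
  moreover have "- C2 - - c (\<lambda>_. a) = (- 1) \<cdot>\<^sub>m (C2 - c (\<lambda>_. a))"
    using C2(1) by (intro eq_matI) auto
  moreover have "rank_le (r3 + r1 + r1 + r4) (four_block_mat (C1 - c (\<lambda>_. a)) (transpose_mat (T - X)) (T - X) ((- 1) \<cdot>\<^sub>m (C2 - c (\<lambda>_. a))))"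
    using C1 C2 T X unfolding c_const[symmetric] TX[symmetric]
    by (intro rank_le_four_block[of _ _ _ _ _ _ _ _ n] rank_le_transpose[of _ _ n n] rank_le_smult[of _ _ n n])
      (simp_all add: minus_carrier_mat)
  ultimately have "rank_le (r3 + r1 + r1 + r4) (A - A')" by simp
  then have R2: "rank_le (r3 + r1 + r1 + r4) R2"
    unfolding R2_def using AA' Pc(2) by (intro rank_le_mult_left[of _ _ "n + n" "n + n" _ "n + n"])
  have R: "rank_le (card S + r2 + (r3 + r1 + r1 + r4)) (R1 + R2)"
    by (rule rank_le_add[OF R1 R2 ER(2) R2c])
  show ?thesis
    using Q ER R2c eq symQ oQ E R by (intro exI[of _ Q] exI[of _ E] exI[of _ "R1 + R2"] conjI) auto
qed

section \<open>Cyclic shifts of Toeplitz matrices\<close>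

text \<open>Multiplication from the left moves row i - 1 to row i, and the last row to row 0;
  multiplication from the right moves column j + 1 to column j. This is the direction that carries a
  diagonal band to the subdiagonals.\<close>

definition cyclic_shift :: "nat \<Rightarrow> real mat" where
  "cyclic_shift n = mat n n (\<lambda>(i, j). if j = (if i = 0 then n - 1 else i - 1) then 1 else 0)"

lemma cyclic_shift_carrier [simp]: "cyclic_shift n \<in> carrier_mat n n"
  by (simp add: cyclic_shift_def)

lemma cyclic_shift_mult_index:
  assumes "A \<in> carrier_mat n k" "i < n" "j < k"
  shows "(cyclic_shift n * A) $$ (i, j) = A $$ (if i = 0 then n - 1 else i - 1, j)"
proof -
  let ?p = "if i = 0 then n - 1 else i - 1"
  have "(cyclic_shift n * A) $$ (i, j) = (\<Sum>l<n. (if l = ?p then 1 else 0) * A $$ (l, j))"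
    using assms by (simp add: cyclic_shift_def scalar_prod_def lessThan_atLeast0)
  also have "\<dots> = (\<Sum>l<n. if l = ?p then A $$ (l, j) else 0)" by (intro sum.cong) auto
  also have "\<dots> = A $$ (?p, j)"
  proof -
    have "?p < n" using assms(2) by auto
    then show ?thesis by simp
  qed
  finally show ?thesis .
qed

lemma mult_cyclic_shift_index:
  assumes "A \<in> carrier_mat k n" "i < k" "j + 1 < n"
  shows "(A * cyclic_shift n) $$ (i, j) = A $$ (i, j + 1)"
proof -
  have "(A * cyclic_shift n) $$ (i, j) = (\<Sum>l<n. A $$ (i, l) * cyclic_shift n $$ (l, j))"
    using assms by (simp add: scalar_prod_def lessThan_atLeast0 cyclic_shift_def)
  also have "\<dots> = (\<Sum>l<n. if l = j + 1 then A $$ (i, l) else 0)"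
    using assms by (intro sum.cong) (auto simp: cyclic_shift_def)
  also have "\<dots> = A $$ (i, j + 1)" using assms by simp
  finally show ?thesis .
qed

lemma orthonormal_cyclic_shift: "orthonormal_mat n (cyclic_shift n)"
proof (rule orthonormal_matI)
  show "cyclic_shift n * transpose_mat (cyclic_shift n) = 1\<^sub>m n"
  proof (rule eq_matI)
    fix i j assume "i < dim_row (1\<^sub>m n :: real mat)" "j < dim_col (1\<^sub>m n :: real mat)"
    then have ij: "i < n" "j < n" by auto
    show "(cyclic_shift n * transpose_mat (cyclic_shift n)) $$ (i, j) = (1\<^sub>m n :: real mat) $$ (i, j)"
      using ij by (subst cyclic_shift_mult_index[of _ n n]) (auto simp: cyclic_shift_def)
  qed (simp_all add: cyclic_shift_def)
qed simp

lemma toeplitz_carrier [simp]: "toeplitz n t \<in> carrier_mat n n"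
  by (simp add: toeplitz_def)

lemma toeplitz_index: "i < n \<Longrightarrow> j < n \<Longrightarrow> toeplitz n t $$ (i, j) = t (int i - int j)"
  by (simp add: toeplitz_def)

text \<open>The support is one row and one column. After row p is split off, the remainder lives in
  column q and is a single row after transposition.\<close>

lemma rank_le_cross:
  assumes A: "A \<in> carrier_mat n n"
    and zero: "\<And>i j. i < n \<Longrightarrow> j < n \<Longrightarrow> i \<noteq> p \<Longrightarrow> j \<noteq> q \<Longrightarrow> A $$ (i, j) = 0"
  shows "rank_le 2 A"
proof -
  define R where "R = mat n n (\<lambda>(i, j). if i = p then A $$ (i, j) else 0)"
  define C where "C = mat n n (\<lambda>(i, j). if i = p then 0 else A $$ (i, j))"
  have "rank_le (card {p}) R" by (rule rank_le_rows[of _ n n]) (auto simp: R_def)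
  moreover have "rank_le (card {q}) (transpose_mat C)"
    by (rule rank_le_rows[of _ n n]) (use zero in \<open>auto simp: C_def\<close>)
  then have "rank_le (card {q}) (transpose_mat (transpose_mat C))"
    by (rule rank_le_transpose[of _ _ n n]) (simp add: C_def)
  ultimately have "rank_le (card {p} + card {q}) (R + C)"
    by (intro rank_le_add[of _ _ _ _ n n]) (simp_all add: R_def C_def)
  moreover have "R + C = A" using A by (intro eq_matI) (auto simp: R_def C_def)
  ultimately show ?thesis by (simp add: numeral_2_eq_2)
qed

text \<open>Entries of a Toeplitz matrix depend only on i - j, so shifting rows and shifting columns
  both yield t (i - 1 - j), except in row 0 and in column n - 1, where the shift wraps
  around.\<close>

lemma rank_le_cyclic_shift_commutator:
  "rank_le 2 (cyclic_shift n * toeplitz n t - toeplitz n t * cyclic_shift n)"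
proof (rule rank_le_cross[of _ n 0 "n - 1"])
  fix i j assume ij: "i < n" "j < n" "i \<noteq> 0" "j \<noteq> n - 1"
  have "(cyclic_shift n * toeplitz n t) $$ (i, j) = t (int (i - 1) - int j)"
    using ij by (simp add: cyclic_shift_mult_index[of _ n n] toeplitz_index)
  moreover have "(toeplitz n t * cyclic_shift n) $$ (i, j) = t (int i - int (j + 1))"
    using ij by (subst mult_cyclic_shift_index[of _ n]) (simp_all add: toeplitz_index)
  moreover have "int (i - 1) - int j = int i - int (j + 1)" using ij by simp
  ultimately show "(cyclic_shift n * toeplitz n t - toeplitz n t * cyclic_shift n) $$ (i, j) = 0"
    using ij by (simp add: diff_diff_eq carrier_matD[OF toeplitz_carrier] carrier_matD[OF cyclic_shift_carrier])
qed (simp add: minus_carrier_mat)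

text \<open>The hypothesis says that b is -t moved down by one diagonal. The sum then vanishes
  outside row 0, the only row filled by the wrap-around.\<close>

lemma rank_le_toeplitz_shifted:
  assumes "\<And>k. b k + t (k - 1) = 0"
  shows "rank_le 1 (toeplitz n b + cyclic_shift n * toeplitz n t)"
proof -
  have "rank_le (card {0 :: nat}) (toeplitz n b + cyclic_shift n * toeplitz n t)"
  proof (rule rank_le_rows[of _ n n])
    fix i j assume ij: "i < n" "j < n" "i \<notin> {0 :: nat}"
    have "(cyclic_shift n * toeplitz n t) $$ (i, j) = t (int (i - 1) - int j)"
      using ij by (simp add: cyclic_shift_mult_index[of _ n n] toeplitz_index)
    also have "int (i - 1) - int j = (int i - int j) - 1" using ij by simp
    finally show "(toeplitz n b + cyclic_shift n * toeplitz n t) $$ (i, j) = 0"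
      using ij assms by (simp add: toeplitz_index carrier_matD[OF toeplitz_carrier] carrier_matD[OF cyclic_shift_carrier])
  qed simp_all
  then show ?thesis by simp
qed

section \<open>Pencils of Kronecker products with a fixed space factor\<close>

text \<open>The common shape of \<open>T_mat\<close> and \<open>G_mat\<close>. It is linear in the
  pair (X, Y) and compatible with multiplication by Z (x) I, so rank statements about n by n
  Toeplitz matrices carry over.\<close>

definition kron_pencil :: "nat \<Rightarrow> real \<Rightarrow> real mat \<Rightarrow> real mat \<Rightarrow> real mat \<Rightarrow> real mat" where
  "kron_pencil m c D X Y = kron X (1\<^sub>m m) - c \<cdot>\<^sub>m kron Y D"

lemma kron_pencil_carrier [simp]:
  "D \<in> carrier_mat m m \<Longrightarrow> Y \<in> carrier_mat n n \<Longrightarrow> kron_pencil m c D X Y \<in> carrier_mat (n * m) (n * m)"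
  by (simp add: kron_pencil_def minus_carrier_mat)

lemma kron_pencil_add:
  assumes "D \<in> carrier_mat m m" "X \<in> carrier_mat n n" "Y \<in> carrier_mat n n" "X' \<in> carrier_mat n n" "Y' \<in> carrier_mat n n"
  shows "kron_pencil m c D X Y + kron_pencil m c D X' Y' = kron_pencil m c D (X + X') (Y + Y')"
  unfolding kron_pencil_def using assms
  by (intro eq_matI) (auto simp: kron_index div_mod_less_mult algebra_simps)

lemma kron_pencil_minus:
  assumes "D \<in> carrier_mat m m" "X \<in> carrier_mat n n" "Y \<in> carrier_mat n n" "X' \<in> carrier_mat n n" "Y' \<in> carrier_mat n n"
  shows "kron_pencil m c D X Y - kron_pencil m c D X' Y' = kron_pencil m c D (X - X') (Y - Y')"
  unfolding kron_pencil_def using assms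
  by (intro eq_matI) (auto simp: kron_index div_mod_less_mult algebra_simps)

lemma kron_pencil_mult_left:
  assumes "D \<in> carrier_mat m m" "X \<in> carrier_mat n n" "Y \<in> carrier_mat n n" "Z \<in> carrier_mat n n"
  shows "kron Z (1\<^sub>m m) * kron_pencil m c D X Y = kron_pencil m c D (Z * X) (Z * Y)"
  unfolding kron_pencil_def using assms
  by (subst mult_minus_distrib_mat[of _ "n * m" "n * m" _ "n * m"])
    (simp_all add: mult_smult_distrib[of _ "n * m" "n * m" _ "n * m"] kron_mult[of _ n n _ m m _ n _ m])

lemma kron_pencil_mult_right:
  assumes "D \<in> carrier_mat m m" "X \<in> carrier_mat n n" "Y \<in> carrier_mat n n" "Z \<in> carrier_mat n n"
  shows "kron_pencil m c D X Y * kron Z (1\<^sub>m m) = kron_pencil m c D (X * Z) (Y * Z)"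
  unfolding kron_pencil_def using assms
  by (subst minus_mult_distrib_mat[of _ "n * m" "n * m" _ _ "n * m"])
    (simp_all add: mult_smult_assoc_mat[of _ "n * m" "n * m" _ "n * m"] kron_mult[of _ n n _ m m _ n _ m])

lemma rank_le_kron_pencil:
  assumes "rank_le r X" "rank_le s Y" "D \<in> carrier_mat m m" "X \<in> carrier_mat n n" "Y \<in> carrier_mat n n"
  shows "rank_le (r * m + s * m) (kron_pencil m c D X Y)"
proof -
  have "rank_le (r * m + s * m) (kron X (1\<^sub>m m) + (- c) \<cdot>\<^sub>m kron Y D)"
    using assms
    by (intro rank_le_add[of _ _ _ _ "n * m" "n * m"] rank_le_smult[of _ _ "n * m" "n * m"] rank_le_kron[of _ _ n n])
      simp_all
  also have "kron X (1\<^sub>m m) + (- c) \<cdot>\<^sub>m kron Y D = kron_pencil m c D X Y"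
    unfolding kron_pencil_def using assms by (intro eq_matI) auto
  finally show ?thesis .
qed

text \<open>Covers \<open>I_hat\<close> and \<open>I_check\<close>, each of which departs from the
  identity in one diagonal entry and hence in one block of size m after the Kronecker
  product.\<close>

lemma rank_le_kron_diag_perturbation:
  assumes "\<And>i. i \<noteq> p \<Longrightarrow> d i = 1"
  shows "rank_le m (a \<cdot>\<^sub>m kron (mat_diag n d) (1\<^sub>m m) - a \<cdot>\<^sub>m 1\<^sub>m (n * m))"
proof -
  have "rank_le (card {p}) (mat_diag n d - 1\<^sub>m n)"
    by (rule rank_le_rows[of _ n n]) (use assms in \<open>auto simp: mat_diag_def minus_carrier_mat\<close>)
  then have "rank_le (1 * m) (kron (mat_diag n d - 1\<^sub>m n) (1\<^sub>m m))"
    by (intro rank_le_kron[of _ _ n n]) (simp_all add: minus_carrier_mat)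
  then have "rank_le m (a \<cdot>\<^sub>m kron (mat_diag n d - 1\<^sub>m n) (1\<^sub>m m))"
    by (simp add: rank_le_smult[of _ _ "n * m" "n * m"] minus_carrier_mat)
  also have "a \<cdot>\<^sub>m kron (mat_diag n d - 1\<^sub>m n) (1\<^sub>m m) = a \<cdot>\<^sub>m kron (mat_diag n d) (1\<^sub>m m) - a \<cdot>\<^sub>m 1\<^sub>m (n * m)"
    by (subst kron_minus_left[of _ n n], simp, simp, unfold kron_one)
      (intro eq_matI; simp add: right_diff_distrib)
  finally show ?thesis .
qed

section \<open>Eigenvalues of G and their growth\<close>

text \<open>With y = x / 2 and y cos y \<le> sin y, the double angle gives sin x = 2 sin y cos y
  \<ge> 2 y (cos y)^2, and (cos y)^2 \<ge> 1 / 2 because cos x \<ge> 0.\<close>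

lemma sin_ge_half:
  assumes "0 \<le> x" "x \<le> pi / 2"
  shows "x / 2 \<le> sin (x :: real)"
proof -
  have *: "y * cos y \<le> sin y" if "0 \<le> y" "y \<le> pi / 2" for y :: real
  proof (cases "y = 0")
    case False
    with that have "0 < y" by simp
    then obtain z where z: "0 < z" "z < y" "sin y - sin 0 = (y - 0) * cos z"
      using MVT2[of 0 y sin cos] by (auto intro: DERIV_sin)
    have "cos y \<le> cos z" using z that by (intro cos_monotone_0_pi_le) auto
    then show ?thesis using z that by (simp add: mult_left_mono)
  qed simp
  define y where "y = x / 2"
  have y: "0 \<le> y" "y \<le> pi / 2" "x = 2 * y" using assms by (auto simp: y_def)
  have c: "cos x = 2 * (cos y)\<^sup>2 - 1" unfolding y(3) by (rule cos_double_cos)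
  have "0 \<le> cos x" using assms by (intro cos_ge_zero) auto
  then have "1 / 2 \<le> (cos y)\<^sup>2" using c by simp
  then have "y * (1 / 2) \<le> y * (cos y)\<^sup>2" using y(1) by (intro mult_left_mono)
  also have "\<dots> = (y * cos y) * cos y" by (simp add: power2_eq_square)
  also have "\<dots> \<le> sin y * cos y"
    using y by (intro mult_right_mono * cos_ge_zero) auto
  also have "2 * \<dots> = sin x" unfolding y(3) by (simp add: sin_double)
  finally show ?thesis
    using \<open>y * (1 / 2) \<le> y * (cos y)\<^sup>2\<close> by (simp add: y_def)
qed

text \<open>2 - 2 cos \<theta> is 4 (sin (\<theta> / 2))^2, where sin (\<theta> / 2) \<ge> \<theta>
  / 4 and \<theta> \<ge> (k + 1) / n, the latter from n + 1 \<le> 2 n and pi \<ge> 2. Thus any bound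
  C / n^2 is exceeded from an index k on that does not depend on n.\<close>

lemma sine_eigenvalue_lower_bound:
  assumes "k < n"
  shows "(real (k + 1))\<^sup>2 / (4 * (real n)\<^sup>2) \<le> 2 - 2 * cos (real (k + 1) * (pi / real (n + 1)))"
proof -
  define \<theta> where "\<theta> = real (k + 1) * (pi / real (n + 1))"
  have "real (k + 1) / real (n + 1) \<le> 1" using assms by simp
  then have "pi * (real (k + 1) / real (n + 1)) \<le> pi * 1" by (intro mult_left_mono) auto
  then have \<theta>: "0 \<le> \<theta>" "\<theta> \<le> pi" by (simp_all add: \<theta>_def mult.commute)
  have n: "real n > 0" using assms by simp
  have "real (k + 1) / real n \<le> \<theta>"
  proof -
    have "real (n + 1) \<le> 2 * real n" using assms by simp
    then have "1 / real n \<le> 2 / real (n + 1)" using n by (simp add: field_simps)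
    also have "\<dots> \<le> pi / real (n + 1)" by (intro divide_right_mono pi_ge_two) simp
    finally have "real (k + 1) * (1 / real n) \<le> real (k + 1) * (pi / real (n + 1))"
      by (rule mult_left_mono) simp
    then show ?thesis by (simp add: \<theta>_def)
  qed
  moreover have "\<theta> / 4 \<le> sin (\<theta> / 2)"
    using sin_ge_half[of "\<theta> / 2"] \<theta> by simp
  ultimately have "real (k + 1) / (4 * real n) \<le> sin (\<theta> / 2)" by simp
  then have "(real (k + 1) / (4 * real n))\<^sup>2 \<le> (sin (\<theta> / 2))\<^sup>2"
    by (intro power_mono) simp_all
  moreover have "cos \<theta> = 1 - 2 * (sin (\<theta> / 2))\<^sup>2"
    using cos_double_sin[of "\<theta> / 2"] by simp
  ultimately show ?thesis
    unfolding \<theta>_def[symmetric] by (simp add: power_divide power_mult_distrib)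
qed

lemma kron_pencil_conj_diag:
  assumes U: "U \<in> carrier_mat n n" and oV: "orthonormal_mat m V"
  shows "kron_pencil m c (conj_diag m V d) (conj_diag n U x) (conj_diag n U y)
    = conj_diag (n * m) (kron U V) (\<lambda>i. x (i div m) - c * (y (i div m) * d (i mod m)))"
proof -
  note V = orthonormal_matD(1)[OF oV]
  have one: "1\<^sub>m m = conj_diag m V (\<lambda>_. 1)"
    unfolding conj_diag_const[OF oV] by (intro eq_matI) auto
  show ?thesis
    unfolding kron_pencil_def one using U V
    by (simp add: kron_conj_diag conj_diag_smult[of _ "n * m"] conj_diag_minus[of _ "n * m"])
qed

text \<open>The eigenvalue of \<open>G_mat\<close> for time frequency i div m + 1 and space mode i
  mod m, when c is tau^2 / 2 and d lists the eigenvalues of \<Delta>.\<close>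

definition pencil_eigenvalue :: "nat \<Rightarrow> nat \<Rightarrow> real \<Rightarrow> (nat \<Rightarrow> real) \<Rightarrow> nat \<Rightarrow> real" where
  "pencil_eigenvalue m n c d i =
     2 - 2 * cos (real (i div m + 1) * (pi / real (n + 1)))
       + 2 * c * cos (real (i div m + 1) * (pi / real (n + 1))) * d (i mod m)"

lemma G_mat_diagonalization:
  assumes oV: "orthonormal_mat m V"
  shows "G_mat m (conj_diag m V d) T n
    = conj_diag (n * m) (kron (sine_mat n) V) (pencil_eigenvalue m n ((tau T n)\<^sup>2 / 2) d)"
proof -
  let ?c = "\<lambda>k. cos (real (k + 1) * (pi / real (n + 1)))"
  note oS = orthonormal_sine_mat[of n]
  note S = orthonormal_matD(1)[OF oS]
  have "G1 n = conj_diag n (sine_mat n) (\<lambda>_. 2) + conj_diag n (sine_mat n) (\<lambda>k. - 2 * ?c k)"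
    unfolding G1_eq conj_diag_const[OF oS] G2_sine[symmetric] ..
  then have G1: "G1 n = conj_diag n (sine_mat n) (\<lambda>k. 2 + - 2 * ?c k)"
    by (simp only: conj_diag_add[OF S])
  have "G_mat m (conj_diag m V d) T n
      = kron_pencil m ((tau T n)\<^sup>2 / 2) (conj_diag m V d) (G1 n) (G2 n)"
    by (simp add: G_mat_def kron_pencil_def)
  also have "\<dots> = conj_diag (n * m) (kron (sine_mat n) V)
      (\<lambda>i. 2 + - 2 * ?c (i div m) - (tau T n)\<^sup>2 / 2 * (- 2 * ?c (i div m) * d (i mod m)))"
    unfolding G1 G2_sine by (rule kron_pencil_conj_diag[OF S oV])
  also have "\<dots> = conj_diag (n * m) (kron (sine_mat n) V) (pencil_eigenvalue m n ((tau T n)\<^sup>2 / 2) d)"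
    by (rule conj_diag_cong) (simp add: pencil_eigenvalue_def algebra_simps)
  finally show ?thesis .
qed

text \<open>The space term 2 c cos \<theta> d_j has absolute value at most 2 c L; with c
  proportional to 1 / n^2 it is a perturbation on the scale of the smallest time
  eigenvalues.\<close>

lemma pencil_eigenvalue_lower_bound:
  assumes "0 \<le> c" "i < n * m" and d: "\<And>j. j < m \<Longrightarrow> \<bar>d j\<bar> \<le> L"
  shows "2 - 2 * cos (real (i div m + 1) * (pi / real (n + 1))) - 2 * c * L \<le> pencil_eigenvalue m n c d i"
proof -
  let ?x = "cos (real (i div m + 1) * (pi / real (n + 1)))"
  have "\<bar>?x * d (i mod m)\<bar> \<le> 1 * L"
    unfolding abs_mult using d[OF div_mod_less_mult(2)[OF assms(2)]]
    by (intro mult_mono) auto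
  then have "- L \<le> ?x * d (i mod m)" by simp
  then have "2 * c * - L \<le> 2 * c * (?x * d (i mod m))"
    using assms(1) by (intro mult_left_mono) auto
  then show ?thesis by (simp add: pencil_eigenvalue_def mult.assoc)
qed

section \<open>Choice of the constants, rank count and assembly of the splitting\<close>

theorem theorem3p14:
  fixes m :: nat and \<Delta> :: "real mat" and T \<gamma> :: real
  assumes "m \<ge> 1"
    and "\<Delta> \<in> carrier_mat m m"
    and "sym_pos_def m (- \<Delta>)"
    and "T > 0" and "\<gamma> > 0"
  shows "\<forall>\<epsilon>::real. \<epsilon> > 0 \<longrightarrow> (\<exists>K::nat. \<forall>n::nat. n > 4 * K * m \<longrightarrow>
    (\<exists>Q E R. Q \<in> carrier_mat (2 * m * n) (2 * m * n)
       \<and> E \<in> carrier_mat (2 * m * n) (2 * m * n)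
       \<and> R \<in> carrier_mat (2 * m * n) (2 * m * n)
       \<and> inv_mat (P_G m \<Delta> T \<gamma> n) * A_mat m \<Delta> T \<gamma> n = Q + E + R
       \<and> symmetric_mat Q \<and> orthonormal_mat (2 * m * n) Q
       \<and> norm2_mat E \<le> \<epsilon>
       \<and> vec_space.rank (2 * m * n) R \<le> (8 * K + 2) * m))"
proof (intro allI impI)
  fix \<epsilon> :: real assume \<epsilon>: "\<epsilon> > 0"
  have "transpose_mat \<Delta> = \<Delta>"
    using assms(3) unfolding sym_pos_def_def symmetric_mat_def transpose_uminus by simp
  then obtain V d where oV: "orthonormal_mat m V" and \<Delta>: "\<Delta> = conj_diag m V d"
    using symmetric_mat_diagonalizable[OF assms(2)] unfolding symmetric_mat_def conj_diag_def by blast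
  \<comment> \<open>A crude bound on all eigenvalues of \<Delta>; what matters is that it does not
    depend on n.\<close>
  define L where "L = (\<Sum>j<m. \<bar>d j\<bar>)"
  have L: "\<bar>d j\<bar> \<le> L" if "j < m" for j
    unfolding L_def using that by (intro member_le_sum) auto
  have L0: "0 \<le> L" unfolding L_def by (intro sum_nonneg) simp
  \<comment> \<open>Chosen so that b / n^2 = a + 4 c L, the bound on |h - g| below: a is T^2 / sqrt
    \<gamma> / n^2 and 2 c is T^2 / n^2.\<close>
  define b where "b = T\<^sup>2 * (1 / sqrt \<gamma> + 2 * L)"
  have b: "b > 0" unfolding b_def using assms(4,5) L0 by (intro mult_pos_pos add_pos_nonneg) auto
  \<comment> \<open>After division by 4 n^2 the left side becomes 2 c L + M with M = 2 b /
    (\<epsilon> n^2). Time frequencies above K0 then have eigenvalues of at least M; of their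
    quadratic growth only k + 1 \<le> (k + 1)^2 is used.\<close>
  obtain K0 :: nat where K0: "4 * (T\<^sup>2 * L + 2 * b / \<epsilon>) \<le> real K0"
    using real_arch_simple by blast
  \<comment> \<open>The increment pays for the ranks that do not depend on \<epsilon>: 4 m from the
    commutator and 6 m from A - A'. In total (K0 + 10) m \<le> (8 K0 + 10) m = (8 K + 2) m.\<close>
  define K where "K = K0 + 1"
  show "\<exists>K::nat. \<forall>n::nat. n > 4 * K * m \<longrightarrow>
    (\<exists>Q E R. Q \<in> carrier_mat (2 * m * n) (2 * m * n)
       \<and> E \<in> carrier_mat (2 * m * n) (2 * m * n)
       \<and> R \<in> carrier_mat (2 * m * n) (2 * m * n)
       \<and> inv_mat (P_G m \<Delta> T \<gamma> n) * A_mat m \<Delta> T \<gamma> n = Q + E + R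
       \<and> symmetric_mat Q \<and> orthonormal_mat (2 * m * n) Q
       \<and> norm2_mat E \<le> \<epsilon>
       \<and> vec_space.rank (2 * m * n) R \<le> (8 * K + 2) * m)"
  proof (intro exI[of _ K] allI impI)
    fix n :: nat assume "n > 4 * K * m"
    then have n: "n > 0" by simp
    then have n2: "(real n)\<^sup>2 > 0" by simp
    define N where "N = n * m"
    define c where "c = (tau T n)\<^sup>2 / 2"
    define a where "a = alpha T \<gamma> n"
    define g where "g = pencil_eigenvalue m n c d"
    define Z where "Z = kron (cyclic_shift n) (1\<^sub>m m)"
    define G where "G = G_mat m \<Delta> T n"
    define \<beta> where "\<beta> = b / (real n)\<^sup>2"
    \<comment> \<open>Makes the error bound 2 \<beta> / M equal to \<epsilon>.\<close>
    define M where "M = 2 * \<beta> / \<epsilon>"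
    have c: "0 \<le> c" "2 * c = T\<^sup>2 / (real n)\<^sup>2" by (simp_all add: c_def tau_def power_divide)
    have a: "a = T\<^sup>2 / sqrt \<gamma> / (real n)\<^sup>2" by (simp add: a_def alpha_def tau_def power_divide)
    have a0: "a > 0" unfolding a using assms(4,5) n2 by simp
    have \<beta>: "\<beta> = a + 2 * (2 * c * L)"
      unfolding \<beta>_def b_def a c(2) by (simp add: add_divide_distrib distrib_left)
    have \<beta>0: "\<beta> > 0" unfolding \<beta>_def using b n2 by simp
    have M0: "M > 0" unfolding M_def using \<beta>0 \<epsilon> by simp
    have glow: "2 - 2 * cos (real (i div m + 1) * (pi / real (n + 1))) - 2 * c * L \<le> g i" if "i < N" for i
      unfolding g_def using pencil_eigenvalue_lower_bound[OF c(1) _ L, of i n] that by (simp add: N_def)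
    \<comment> \<open>From |g| \<le> h \<le> |g| + a one gets 0 \<le> h - g \<le> a + (|g| - g).
      Since g \<ge> - 2 c L, the last bracket is at most 4 c L.\<close>
    have hg: "\<bar>sqrt ((g i)\<^sup>2 + a\<^sup>2) - g i\<bar> \<le> \<beta>" if i: "i < N" for i
    proof -
      have "- (2 * c * L) \<le> g i"
        using glow[OF i] cos_le_one[of "real (i div m + 1) * (pi / real (n + 1))"] by linarith
      moreover have "sqrt ((g i)\<^sup>2 + a\<^sup>2) \<le> \<bar>g i\<bar> + \<bar>a\<bar>" by (rule sqrt_sum_squares_le_sum_abs)
      moreover have "\<bar>g i\<bar> \<le> sqrt ((g i)\<^sup>2 + a\<^sup>2)" by (rule real_sqrt_ge_abs1)
      moreover have "0 \<le> 2 * c * L" using c(1) L0 by simp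
      ultimately show ?thesis unfolding \<beta> using a0 by linarith
    qed
    \<comment> \<open>The exceptional indices belong to the first K0 time frequencies, each with m
      space modes, and the flat index i = k m + j makes them an initial segment.\<close>
    have small: "i \<in> {..<K0 * m}" if i: "i < N" "sqrt ((g i)\<^sup>2 + a\<^sup>2) < M" for i
    proof (rule ccontr)
      assume "i \<notin> {..<K0 * m}"
      then have "K0 * m \<le> i" by simp
      then have "K0 * m div m \<le> i div m" by (rule div_le_mono)
      then have k: "K0 \<le> i div m" using assms(1) by simp
      have kn: "i div m < n" using i(1) div_mod_less_mult(1) by (simp add: N_def)
      have "real K0 \<le> real (i div m + 1)" using k by simp
      also have "\<dots> \<le> (real (i div m + 1))\<^sup>2" by (rule self_le_power) auto
      finally have "(T\<^sup>2 * L + 2 * b / \<epsilon>) \<le> (real (i div m + 1))\<^sup>2 / 4" using K0 by simp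
      then have "(T\<^sup>2 * L + 2 * b / \<epsilon>) / (real n)\<^sup>2 \<le> (real (i div m + 1))\<^sup>2 / 4 / (real n)\<^sup>2"
        by (rule divide_right_mono) simp
      also have "\<dots> \<le> 2 - 2 * cos (real (i div m + 1) * (pi / real (n + 1)))"
        using sine_eigenvalue_lower_bound[OF kn] by simp
      also have "(T\<^sup>2 * L + 2 * b / \<epsilon>) / (real n)\<^sup>2 = 2 * c * L + M"
        unfolding M_def \<beta>_def c(2) by (simp add: add_divide_distrib)
      finally have "M \<le> g i" using glow[OF i(1)] by linarith
      also have "g i \<le> \<bar>g i\<bar>" by simp
      also have "\<bar>g i\<bar> \<le> sqrt ((g i)\<^sup>2 + a\<^sup>2)" by (rule real_sqrt_ge_abs1)
      finally show False using i(2) by simp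
    qed
    have oW: "orthonormal_mat N (kron (sine_mat n) V)"
      unfolding N_def by (rule orthonormal_mat_kron[OF orthonormal_sine_mat oV])
    have "orthonormal_mat m (1\<^sub>m m)" by (simp add: orthonormal_mat_def)
    then have oZ: "orthonormal_mat N Z"
      unfolding N_def Z_def by (rule orthonormal_mat_kron[OF orthonormal_cyclic_shift])
    have G: "G = conj_diag N (kron (sine_mat n) V) g"
      unfolding G_def \<Delta> N_def g_def c_def by (rule G_mat_diagonalization[OF oV])
    have Gp: "G = kron_pencil m c \<Delta> (G1 n) (G2 n)" by (simp add: G_def G_mat_def kron_pencil_def c_def)
    have Tp: "T_mat m \<Delta> T n = kron_pencil m c \<Delta> (B1 n) (B2 n)"
      by (simp add: T_mat_def kron_pencil_def c_def)
    have carr: "G1 n \<in> carrier_mat n n" "G2 n \<in> carrier_mat n n" "B1 n \<in> carrier_mat n n" "B2 n \<in> carrier_mat n n"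
      by (simp_all add: G1_def G2_def B1_def B2_def)
    have Tc: "T_mat m \<Delta> T n \<in> carrier_mat N N"
      unfolding Tp N_def using assms(2) carr by simp
    have TZ: "rank_le (1 * m + 1 * m) (T_mat m \<Delta> T n + Z * G)"
    proof -
      have "T_mat m \<Delta> T n + Z * G
        = kron_pencil m c \<Delta> (B1 n + cyclic_shift n * G1 n) (B2 n + cyclic_shift n * G2 n)"
        unfolding Tp Gp Z_def using assms(2) carr
        by (simp add: kron_pencil_mult_left[of _ _ _ n] kron_pencil_add[of _ _ _ n])
      \<comment> \<open>The bands are (1, -2, 1) against (-1, 2, -1) and (1, 0, 1) against (-1, 0,
        -1), in each case displaced by one diagonal.\<close>
      moreover have "rank_le 1 (B1 n + cyclic_shift n * G1 n)" "rank_le 1 (B2 n + cyclic_shift n * G2 n)"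
        unfolding B1_def B2_def G1_def G2_def by (rule rank_le_toeplitz_shifted; auto)+
      ultimately show ?thesis
        using assms(2) carr by (simp only:) (intro rank_le_kron_pencil[of _ _ _ _ _ _ n]; simp)
    qed
    have comm: "rank_le (2 * m + 2 * m) (Z * G - G * Z)"
    proof -
      have "Z * G - G * Z = kron_pencil m c \<Delta> (cyclic_shift n * G1 n - G1 n * cyclic_shift n)
          (cyclic_shift n * G2 n - G2 n * cyclic_shift n)"
        unfolding Gp Z_def using assms(2) carr
        by (simp add: kron_pencil_mult_left[of _ _ _ n] kron_pencil_mult_right[of _ _ _ n] kron_pencil_minus[of _ _ _ n])
      moreover have "rank_le 2 (cyclic_shift n * G1 n - G1 n * cyclic_shift n)"
        "rank_le 2 (cyclic_shift n * G2 n - G2 n * cyclic_shift n)"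
        unfolding G1_def G2_def by (rule rank_le_cyclic_shift_commutator)+
      ultimately show ?thesis
        using assms(2) carr by (simp only:) (intro rank_le_kron_pencil[of _ _ _ _ _ _ n]; simp add: minus_carrier_mat)
    qed
    have C1: "a \<cdot>\<^sub>m kron (I_check n) (1\<^sub>m m) \<in> carrier_mat N N"
      "rank_le m (a \<cdot>\<^sub>m kron (I_check n) (1\<^sub>m m) - a \<cdot>\<^sub>m 1\<^sub>m N)"
      unfolding N_def I_check_def by (simp, rule rank_le_kron_diag_perturbation[of "n - 1"], auto)
    have C2: "a \<cdot>\<^sub>m kron (I_hat n) (1\<^sub>m m) \<in> carrier_mat N N"
      "rank_le m (a \<cdot>\<^sub>m kron (I_hat n) (1\<^sub>m m) - a \<cdot>\<^sub>m 1\<^sub>m N)"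
      unfolding N_def I_hat_def by (simp, rule rank_le_kron_diag_perturbation[of 0], auto)
    have P: "P_G m \<Delta> T \<gamma> n = four_block_mat (sqrt_mat (transpose_mat G * G + a\<^sup>2 \<cdot>\<^sub>m 1\<^sub>m N)) (0\<^sub>m N N) (0\<^sub>m N N)
                  (sqrt_mat (G * transpose_mat G + a\<^sup>2 \<cdot>\<^sub>m 1\<^sub>m N))"
      by (simp add: P_G_def Let_def G_def a_def N_def mult.commute)
    have A: "A_mat m \<Delta> T \<gamma> n = four_block_mat (a \<cdot>\<^sub>m kron (I_check n) (1\<^sub>m m)) (transpose_mat (T_mat m \<Delta> T n))
        (T_mat m \<Delta> T n) (- (a \<cdot>\<^sub>m kron (I_hat n) (1\<^sub>m m)))"
      by (simp add: A_mat_def a_def)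
    obtain Q E R where Q: "Q \<in> carrier_mat (N + N) (N + N)" "symmetric_mat Q" "orthonormal_mat (N + N) Q"
      and R: "R \<in> carrier_mat (N + N) (N + N)"
        "rank_le (card {..<K0 * m} + (2 * m + 2 * m) + (m + (1 * m + 1 * m) + (1 * m + 1 * m) + m)) R"
      and eq: "inv_mat (P_G m \<Delta> T \<gamma> n) * A_mat m \<Delta> T \<gamma> n = Q + E + R"
      and E: "norm_bounded (N + N) (2 * \<beta> / M) E"
      using preconditioned_splitting[OF oW oZ a0 G hg less_imp_le[OF \<beta>0] M0 finite_lessThan small Tc TZ comm C1 C2 P A]
      by blast
    have dim: "N + N = 2 * m * n" by (simp add: N_def)
    have "N > 0" using n assms(1) by (simp add: N_def)
    moreover have "2 * \<beta> / M = \<epsilon>" unfolding M_def using \<beta>0 \<epsilon> by simp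
    ultimately have "norm2_mat E \<le> \<epsilon>" using norm2_mat_le[OF E] \<epsilon> by simp
    moreover have "vec_space.rank (N + N) R \<le> (8 * K + 2) * m"
    proof -
      have "vec_space.rank (N + N) R \<le> card {..<K0 * m} + (2 * m + 2 * m) + (m + (1 * m + 1 * m) + (1 * m + 1 * m) + m)"
        by (rule rank_le_rank[OF R(2,1)])
      also have "\<dots> \<le> (8 * K + 2) * m" by (simp add: K_def algebra_simps)
      finally show ?thesis .
    qed
    moreover have "E \<in> carrier_mat (N + N) (N + N)" using E by (simp add: norm_bounded_def)
    ultimately show "\<exists>Q E R. Q \<in> carrier_mat (2 * m * n) (2 * m * n)
       \<and> E \<in> carrier_mat (2 * m * n) (2 * m * n)
       \<and> R \<in> carrier_mat (2 * m * n) (2 * m * n)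
       \<and> inv_mat (P_G m \<Delta> T \<gamma> n) * A_mat m \<Delta> T \<gamma> n = Q + E + R
       \<and> symmetric_mat Q \<and> orthonormal_mat (2 * m * n) Q
       \<and> norm2_mat E \<le> \<epsilon>
       \<and> vec_space.rank (2 * m * n) R \<le> (8 * K + 2) * m"
      using Q R(1) eq unfolding dim by blast
  qed
qed

end
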